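(* Let $(X,\mathcal{B},F_1^s,\mu)$ and $(Y,\mathcal{B}',F_2^s,\nu)$ be two ergodic probability measure preserving flows, with $X$ a metric space. Let $c>0$ and assume that $\{t_i\}_{i=1}^\infty$ is a $c$-partial rigidity sequence for $F_1^s$ and that the unitary group $U_{F_2}^s$ satisfies condition ( * ) along $\{t_i\}_{i=1}^\infty$. Then $(F_1^s,\mu)$ and $(F_2^s,\nu)$ are disjoint.
   Context: Spaces are Polish with Borel $\sigma$-algebras. For a flow $F^s$ preserving a probability measure, $U_F^s f=f\circ F^s$ is the associated unitary group on $L^2$. Write $\exp(s)=e^{is}$; an eigenvalue $\exp(s\alpha)$ of $U^s$ ($\alpha\in\mathbb{R}$) means there is a nonzero $f$ with $U^sf=e^{is\alpha}f$ for all $s$. $\mathcal{H}_{pp}$ is the closed span of the eigenfunctions and $\mathcal{H}_c$ its orthogonal complement. Partial rigidity: let $(X,F^s,\mu)$ be an ergodic measure preserving flow on a metric space $(X,d)$. A sequence $\{t_i\}_{i=1}^\infty$ of reals is a $c$-partial rigidity sequence for $F^s$ if there exist measurable sets $S_1,S_2,\dots$ such that (1) $\mu(S_i)\ge c$; (2) $\lim_{i\to\infty}\int_{S_i}d(F^{t_i}x,x)\,d\mu(x)=0$; (3) for each $s$, $\lim_{i\to\infty}\mu(F^sS_i\,\Delta\,S_i)=0$. Condition ( * ): let $U^s$ be a strongly continuous one-parameter unitary group (here $U_F^s$ for a flow $F$) and let $\{\exp(s\alpha_j)\}_j$ be its eigenvalues that do not correspond to constant functions. $U^s$ satisfies ( *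 ) along $\{t_i\}$ if (1) for all $j$, $\inf_i|\exp(t_i\alpha_j)-1|>0$; and (2) $U^{t_i}f$ converges weakly to $0$ for all $f\in\mathcal{H}_c$. A joining of $(F_1,\mu)$ and $(F_2,\nu)$ is a probability measure on $X\times Y$ invariant under $F_1^s\times F_2^s$ with marginals $\mu$ and $\nu$; the flows are disjoint if $\mu\times\nu$ is their only joining. *)

theory Defs
  imports "HOL-Probability.Probability"
begin

text \<open>
  A flow is a jointly measurable action of the reals. The underlying Polish space is the
  whole type \<^typ>\<open>'a\<close>; \<open>sets_eq_borel\<close> forces \<open>space M = UNIV\<close>.
\<close>

locale pmp_flow = prob_space M
  for M :: "'a::second_countable_topology measure" +
  fixes F :: "real \<Rightarrow> 'a \<Rightarrow> 'a"
  assumes polish: "completely_metrizable_space (euclidean :: 'a topology)"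
    and sets_eq_borel: "sets M = sets borel"
    and measurable_flow: "(\<lambda>(s, x). F s x) \<in> measurable (borel \<Otimes>\<^sub>M M) M"
    and flow_0: "F 0 x = x"
    and flow_add: "F (s + t) x = F s (F t x)"
    and measure_preserving: "distr M M (F s) = M"

locale ergodic_pmp_flow = pmp_flow +
  assumes ergodic:
    "\<lbrakk>A \<in> sets M; \<And>s. F s -` A = A\<rbrakk> \<Longrightarrow> measure M A = 0 \<or> measure M A = 1"

text \<open>
  The integral is the nonnegative one, since the metric may be unbounded and the Bochner
  integral of a non-integrable function is 0.
\<close>

definition partial_rigidity_seq ::
  "'a::{metric_space, second_countable_topology} measure \<Rightarrow> (real \<Rightarrow> 'a \<Rightarrow> 'a)
    \<Rightarrow> real \<Rightarrow> (nat \<Rightarrow> real) \<Rightarrow> bool" where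
  "partial_rigidity_seq M F c t \<longleftrightarrow>
    (\<exists>S :: nat \<Rightarrow> 'a set.
      (\<forall>i. S i \<in> sets M \<and> c \<le> measure M (S i)) \<and>
      (\<lambda>i. \<integral>\<^sup>+x\<in>S i. ennreal (dist (F (t i) x) x) \<partial>M) \<longlonglongrightarrow> 0 \<and>
      (\<forall>s. (\<lambda>i. measure M (sym_diff (F s ` S i) (S i))) \<longlonglongrightarrow> 0))"

text \<open>
  Elements of $L^2$ are represented by functions; identities between them are read almost
  everywhere. A one-parameter group is given by its action \<open>U s\<close> on representatives.
\<close>

definition square_integrable :: "'a measure \<Rightarrow> ('a \<Rightarrow> complex) set" where
  "square_integrable M =
    {f \<in> borel_measurable M. integrable M (\<lambda>x. (cmod (f x))\<^sup>2)}"

definition l2_inner :: "'a measure \<Rightarrow> ('a \<Rightarrow> complex) \<Rightarrow> ('a \<Rightarrow> complex) \<Rightarrow> complex" where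
  "l2_inner M f g = (\<integral>x. f x * cnj (g x) \<partial>M)"

definition l2_norm :: "'a measure \<Rightarrow> ('a \<Rightarrow> complex) \<Rightarrow> real" where
  "l2_norm M f = sqrt (\<integral>x. (cmod (f x))\<^sup>2 \<partial>M)"

definition koopman :: "(real \<Rightarrow> 'a \<Rightarrow> 'a) \<Rightarrow> real \<Rightarrow> ('a \<Rightarrow> complex) \<Rightarrow> 'a \<Rightarrow> complex" where
  "koopman F s f = f \<circ> F s"

definition eigenfunction ::
  "'a measure \<Rightarrow> (real \<Rightarrow> ('a \<Rightarrow> complex) \<Rightarrow> 'a \<Rightarrow> complex) \<Rightarrow> real \<Rightarrow> ('a \<Rightarrow> complex) \<Rightarrow> bool"
  where
  "eigenfunction M U \<alpha> f \<longleftrightarrow>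
    f \<in> square_integrable M \<and> \<not> (AE x in M. f x = 0) \<and>
    (\<forall>s. AE x in M. U s f x = cis (s * \<alpha>) * f x)"

definition nonconstant_eigenvalue ::
  "'a measure \<Rightarrow> (real \<Rightarrow> ('a \<Rightarrow> complex) \<Rightarrow> 'a \<Rightarrow> complex) \<Rightarrow> real \<Rightarrow> bool" where
  "nonconstant_eigenvalue M U \<alpha> \<longleftrightarrow>
    (\<exists>f. eigenfunction M U \<alpha> f \<and> \<not> (\<exists>c. AE x in M. f x = c))"

text \<open>The closed linear span of all eigenfunctions, the constants included.\<close>

definition H_pp ::
  "'a measure \<Rightarrow> (real \<Rightarrow> ('a \<Rightarrow> complex) \<Rightarrow> 'a \<Rightarrow> complex) \<Rightarrow> ('a \<Rightarrow> complex) set" where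
  "H_pp M U =
    {f \<in> square_integrable M. \<forall>\<epsilon>>0. \<exists>(n::nat) (a :: nat \<Rightarrow> complex) e.
      (\<forall>k<n. \<exists>\<alpha>. eigenfunction M U \<alpha> (e k)) \<and>
      l2_norm M (\<lambda>x. f x - (\<Sum>k<n. a k * e k x)) < \<epsilon>}"

definition H_c ::
  "'a measure \<Rightarrow> (real \<Rightarrow> ('a \<Rightarrow> complex) \<Rightarrow> 'a \<Rightarrow> complex) \<Rightarrow> ('a \<Rightarrow> complex) set" where
  "H_c M U = {f \<in> square_integrable M. \<forall>g \<in> H_pp M U. l2_inner M f g = 0}"

definition condition_star ::
  "'a measure \<Rightarrow> (real \<Rightarrow> ('a \<Rightarrow> complex) \<Rightarrow> 'a \<Rightarrow> complex) \<Rightarrow> (nat \<Rightarrow> real) \<Rightarrow> bool" where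
  "condition_star M U t \<longleftrightarrow>
    (\<forall>\<alpha>. nonconstant_eigenvalue M U \<alpha> \<longrightarrow> 0 < (INF i. cmod (cis (t i * \<alpha>) - 1))) \<and>
    (\<forall>f \<in> H_c M U. \<forall>g \<in> square_integrable M. (\<lambda>i. l2_inner M (U (t i) f) g) \<longlonglongrightarrow> 0)"

definition joining ::
  "'a measure \<Rightarrow> (real \<Rightarrow> 'a \<Rightarrow> 'a) \<Rightarrow> 'b measure \<Rightarrow> (real \<Rightarrow> 'b \<Rightarrow> 'b) \<Rightarrow> ('a \<times> 'b) measure \<Rightarrow> bool"
  where
  "joining M F N G L \<longleftrightarrow>
    prob_space L \<and> sets L = sets (M \<Otimes>\<^sub>M N) \<and>
    distr L M fst = M \<and> distr L N snd = N \<and>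
    (\<forall>s. distr L L (map_prod (F s) (G s)) = L)"

definition disjoint_flows ::
  "'a measure \<Rightarrow> (real \<Rightarrow> 'a \<Rightarrow> 'a) \<Rightarrow> 'b measure \<Rightarrow> (real \<Rightarrow> 'b \<Rightarrow> 'b) \<Rightarrow> bool" where
  "disjoint_flows M F N G \<longleftrightarrow> {L. joining M F N G L} = {M \<Otimes>\<^sub>M N}"

end

theory Submission
  imports Defs
begin

text \<open>
  Write \<open>\<mu>\<close>, \<open>\<nu>\<close> for the two measures and let \<open>L\<close> be a joining. Two principles drive the argument.

  \<^item> Equidistribution: since the first flow is ergodic, the asymptotically invariant sets \<open>S\<^sub>i\<close> of the
    partial rigidity assumption behave like constants in weak limits. Integrals over \<open>S\<^sub>i \<times> Y\<close> of a fixed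
    integrable function are asymptotically \<open>\<mu>(S\<^sub>i)\<close> times its integral, even on \<open>L\<close>
    (\<open>asymptotically_invariant_equidistributed_extension\<close>).

  \<^item> Rigidity: for every measurable set \<open>A\<close>, the points of \<open>S\<^sub>i\<close> that enter or leave \<open>A\<close> at time \<open>t\<^sub>i\<close>
    have vanishing measure (\<open>partial_rigidity_moves_sets_little\<close>). So on \<open>S\<^sub>i\<close> the flow may be applied to
    the \<open>y\<close>-coordinate alone.

  Fix a set \<open>A\<close> of the first space and let \<open>h(y)\<close> be the conditional probability of \<open>x \<in> A\<close> given \<open>y\<close>. The
  two principles show that nonconstant eigenfunctions of the second flow are uncorrelated with \<open>A\<close>
  (\<open>eigenfunction_uncorrelated\<close>): applying the flow to \<open>y\<close> alone multiplies the correlation by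
  \<open>exp(t\<^sub>i \<alpha>)\<close>, which stays away from 1. Hence \<open>h - \<mu>(A)\<close> lies in the continuous part \<open>H\<^sub>c\<close>, and condition
  (*) gives \<open>h \<circ> F\<^sub>2\<^sup>t \<rightarrow> \<mu>(A)\<close> weakly along \<open>t\<^sub>i\<close>.

  Consequently \<open>(F\<^sub>1\<^sup>t \<times> id) L\<close> tends to \<open>\<mu> \<times> \<nu>\<close> on rectangles, while the part of it that comes from \<open>S\<^sub>i\<close> is
  about \<open>\<mu>(S\<^sub>i) L\<close>. Therefore \<open>c L \<le> \<mu> \<times> \<nu>\<close> (\<open>rectangle_domination\<close>, \<open>domination_from_rectangles\<close>), and \<open>L\<close> has
  a bounded density with respect to the product.

  It remains to identify \<open>L\<close>. One could deduce from the absence of common eigenvalues that \<open>\<mu> \<times> \<nu>\<close> is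
  ergodic, so that an invariant density is constant. The following avoids the spectral theory behind
  that deduction and uses the mixing of \<open>h\<close> once more. The averages of
  \<open>1\<^sub>A(F\<^sub>1\<^sup>t x) h(F\<^sub>2\<^sup>t y)\<close> over \<open>S\<^sub>i\<close> are computed twice. Equidistribution gives \<open>\<integral> h\<^sup>2 d\<nu>\<close>. Rigidity, weak
  convergence of \<open>h \<circ> F\<^sub>2\<^sup>t\<close> and the bounded density give \<open>\<mu>(A)\<^sup>2\<close>. So \<open>h\<close> is constant
  (\<open>joining_eq_product\<close>). The density is what allows the weak limit to be used although the sets
  \<open>S\<^sub>i\<close> vary with \<open>i\<close> as well.
\<close>

section \<open>Densities and cluster points\<close>

text \<open>
  The density given by Radon--Nikodym is at most \<open>C\<close> almost everywhere, because the set where it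
  exceeds \<open>C\<close> cannot have larger \<open>K\<close>-measure than \<open>C\<close> times its \<open>M\<close>-measure; it is then truncated so
  that the bounds hold at every point.
\<close>

lemma bounded_density:
  assumes "finite_measure M" and sets: "sets K = sets M"
    and dom: "\<And>A. A \<in> sets M \<Longrightarrow> emeasure K A \<le> ennreal C * emeasure M A"
    and "0 \<le> C"
  obtains h where "h \<in> borel_measurable M" "\<And>x. 0 \<le> h x" "\<And>x. h x \<le> C"
    "K = density M (\<lambda>x. ennreal (h x))"
proof -
  interpret finite_measure M by fact
  have ac: "absolutely_continuous M K"
    unfolding absolutely_continuous_def
  proof
    fix A assume "A \<in> null_sets M"
    then show "A \<in> null_sets K"
      using dom[of A] sets by (auto simp: null_sets_def)
  qed
  obtain f where f[measurable]: "f \<in> borel_measurable M" and Kf: "density M f = K"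
    using Radon_Nikodym[OF ac sets] by auto
  define B where "B = {x \<in> space M. f x > ennreal C}"
  have B[measurable]: "B \<in> sets M" unfolding B_def by measurable
  have "emeasure K B = (\<integral>\<^sup>+x. f x * indicator B x \<partial>M)"
    unfolding Kf[symmetric] by (simp add: emeasure_density)
  then have 1: "(\<integral>\<^sup>+x. f x * indicator B x \<partial>M) \<le> (\<integral>\<^sup>+x. ennreal C * indicator B x \<partial>M)"
    using dom[OF B] by (simp add: nn_integral_cmult)
  have fin: "(\<integral>\<^sup>+x. ennreal C * indicator B x \<partial>M) < top"
    by (simp add: nn_integral_cmult ennreal_mult_less_top emeasure_eq_measure)
  have "(\<integral>\<^sup>+x. f x * indicator B x - ennreal C * indicator B x \<partial>M)
      = (\<integral>\<^sup>+x. f x * indicator B x \<partial>M) - (\<integral>\<^sup>+x. ennreal C * indicator B x \<partial>M)"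
    using fin by (intro nn_integral_diff) (auto simp: B_def split: split_indicator)
  also have "\<dots> = 0" using 1 fin by (intro diff_eq_0_ennreal) auto
  finally have "AE x in M. f x * indicator B x - ennreal C * indicator B x = 0"
    by (subst (asm) nn_integral_0_iff_AE) auto
  with AE_space have le: "AE x in M. f x \<le> ennreal C"
  proof eventually_elim
    case (elim x)
    then show ?case
      by (cases "x \<in> B") (auto simp: B_def diff_eq_0_iff_ennreal)
  qed
  define h where "h = (\<lambda>x. enn2real (min (f x) (ennreal C)))"
  show thesis
  proof
    show "h \<in> borel_measurable M" unfolding h_def by measurable
    show "0 \<le> h x" for x by (simp add: h_def)
    show "h x \<le> C" for x
      unfolding h_def using \<open>0 \<le> C\<close> by (intro enn2real_leI) auto
    have "AE x in M. f x = ennreal (h x)"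
      using le
    proof eventually_elim
      case (elim x)
      then show ?case
        by (auto simp: h_def min_absorb1 ennreal_enn2real_if top_unique)
    qed
    then show "K = density M (\<lambda>x. ennreal (h x))"
      unfolding Kf[symmetric] by (intro density_cong) (auto simp: h_def)
  qed
qed

text \<open>
  The index set may be uncountable, so compactness of the cube \<open>[0, 1]\<close> to the power of it yields a
  cluster point along a finer filter, in general not along a subsequence.
\<close>

lemma Tychonoff_cluster:
  fixes v :: "'n \<Rightarrow> 'i \<Rightarrow> real"
  assumes v: "\<And>n i. v n i \<in> {0..1}" and "H \<noteq> bot"
  obtains H' x where "H' \<le> H" "H' \<noteq> bot" "\<And>i. ((\<lambda>n. v n i) \<longlongrightarrow> x i) H'"
proof -
  define U :: "('i \<Rightarrow> real) set" where "U = PiE UNIV (\<lambda>_. {0..1})"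
  have "compactin (product_topology (\<lambda>i. euclidean) UNIV) U"
    unfolding U_def by (subst compactin_PiE) (auto simp: compactin_euclidean_iff)
  then have U: "compact U"
    by (simp add: euclidean_product_topology compactin_euclidean_iff)
  have "filtermap v H \<noteq> bot" "eventually (\<lambda>x. x \<in> U) (filtermap v H)"
    using assms by (auto simp: filtermap_bot_iff eventually_filtermap U_def PiE_def)
  then obtain x where x: "inf (nhds x) (filtermap v H) \<noteq> bot"
    using U unfolding compact_filter by blast
  define H' where "H' = inf (filtercomap v (nhds x)) H"
  have le: "filtermap v H' \<le> nhds x"
    unfolding H'_def by (meson filtermap_filtercomap filtermap_inf filtermap_mono inf_le1 order_trans)
  show thesis
  proof
    show "H' \<le> H" by (simp add: H'_def)
    show "H' \<noteq> bot"
    proof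
      assume "H' = bot"
      then have "eventually (\<lambda>_. False) H'" by simp
      then obtain P Q where P: "eventually P (filtercomap v (nhds x))" and Q: "eventually Q H"
        and PQ: "\<And>n. P n \<Longrightarrow> Q n \<Longrightarrow> False"
        unfolding H'_def eventually_inf by auto
      from P obtain R where R: "eventually R (nhds x)" "\<And>n. R (v n) \<Longrightarrow> P n"
        unfolding eventually_filtercomap by auto
      have "eventually (\<lambda>y. \<not> R y) (filtermap v H)"
        using Q by (auto simp: eventually_filtermap elim!: eventually_mono dest: PQ R(2))
      then have "eventually (\<lambda>_. False) (inf (nhds x) (filtermap v H))"
        using R(1) unfolding eventually_inf by blast
      with x show False by simp
    qed
    fix i
    have "((\<lambda>y. y i) \<longlongrightarrow> x i) (nhds x)"
    proof (rule topological_tendstoI)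
      fix T :: "real set" assume "open T" "x i \<in> T"
      then show "eventually (\<lambda>y. y i \<in> T) (nhds x)"
        using open_vimage[OF \<open>open T\<close> continuous_on_product_coordinates[of i]]
        unfolding eventually_nhds by (intro exI[of _ "(\<lambda>y. y i) -` T"]) auto
    qed
    moreover have "filterlim v (nhds x) H'" using le by (simp add: filterlim_def)
    ultimately show "((\<lambda>n. v n i) \<longlongrightarrow> x i) H'"
      by (rule filterlim_compose)
  qed
qed

section \<open>Flows and almost invariant sets\<close>

context pmp_flow
begin

lemma space_eq_UNIV: "space M = UNIV"
  using sets_eq_imp_space_eq[OF sets_eq_borel] by simp

lemma measurable_flow_map [measurable]: "F s \<in> measurable M M"
proof -
  have "(\<lambda>x. (s, x)) \<in> measurable M (borel \<Otimes>\<^sub>M M)" by measurable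
  from measurable_compose[OF this measurable_flow] show ?thesis by simp
qed

lemma flow_inverse [simp]: "F s (F (- s) x) = x" "F (- s) (F s x) = x"
  using flow_add[of s "- s" x] flow_add[of "- s" s x] flow_0 by simp_all

lemma flow_image_eq_vimage: "F s ` A = F (- s) -` A"
proof (intro set_eqI iffI)
  fix x assume "x \<in> F (- s) -` A"
  then have "F s (F (- s) x) \<in> F s ` A" by (intro imageI) simp
  then show "x \<in> F s ` A" by simp
qed auto

lemma sets_flow_vimage [measurable]: "A \<in> sets M \<Longrightarrow> F s -` A \<in> sets M"
  using measurable_sets[OF measurable_flow_map, of A s] by (simp add: space_eq_UNIV)

lemma sets_flow_image [measurable]: "A \<in> sets M \<Longrightarrow> F s ` A \<in> sets M"
  by (simp add: flow_image_eq_vimage)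

lemma measure_flow_vimage: "A \<in> sets M \<Longrightarrow> measure M (F s -` A) = measure M A"
  using measure_distr[OF measurable_flow_map, of A s] measure_preserving[of s]
  by (simp add: space_eq_UNIV)

lemma measure_flow_image: "A \<in> sets M \<Longrightarrow> measure M (F s ` A) = measure M A"
  by (simp add: flow_image_eq_vimage measure_flow_vimage)

end

text \<open>
  The ergodicity assumption concerns sets that are invariant at every point. An almost invariant set
  \<open>A\<close> is replaced by the set \<open>A'\<close> of the points whose orbit lies in \<open>A\<close> for Lebesgue-almost every time.
  Translation invariance of Lebesgue measure makes \<open>A'\<close> invariant at every point, and Fubini's theorem
  shows that \<open>A\<close> and \<open>A'\<close> differ by a null set.
\<close>

lemma (in ergodic_pmp_flow) AE_invariant_set_trivial:
  assumes [measurable]: "A \<in> sets M" and inv: "\<And>s. AE x in M. F s x \<in> A \<longleftrightarrow> x \<in> A"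
  shows "measure M A = 0 \<or> measure M A = 1"
proof -
  define A' where "A' = {x. AE s in lborel. F s x \<in> A}"
  interpret P: pair_sigma_finite M lborel
    by (intro pair_sigma_finite.intro) unfold_locales
  have flow_swap[measurable]: "(\<lambda>(x, s). F s x) \<in> measurable (M \<Otimes>\<^sub>M lborel) M"
  proof -
    have "(\<lambda>z. (snd z, fst z)) \<in> measurable (M \<Otimes>\<^sub>M lborel) (borel \<Otimes>\<^sub>M M)" by measurable
    from measurable_compose[OF this measurable_flow] show ?thesis
      by (simp add: split_beta')
  qed
  have "A' = {x \<in> space M. (\<integral>\<^sup>+s. indicator (- A) (F s x) \<partial>lborel) = 0}"
  proof -
    have "(AE s in lborel. F s x \<in> A) \<longleftrightarrow> (\<integral>\<^sup>+s. indicator (- A) (F s x) \<partial>lborel) = 0" for x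
    proof -
      have "(\<lambda>s. (x, s)) \<in> measurable borel (M \<Otimes>\<^sub>M lborel)"
        by (auto simp: space_eq_UNIV)
      from measurable_compose[OF this, of "\<lambda>(x, s). F s x" M]
      have "(\<lambda>s. F s x) \<in> measurable borel M" by simp
      moreover have "- A \<in> sets M"
        using sets.compl_sets[OF assms(1)] by (simp add: space_eq_UNIV Compl_eq_Diff_UNIV)
      ultimately have "(\<lambda>s. indicator (- A) (F s x) :: ennreal) \<in> borel_measurable borel"
        using borel_measurable_indicator measurable_compose by blast
      then show ?thesis
        by (subst nn_integral_0_iff_AE) (auto simp: indicator_eq_0_iff)
    qed
    then show ?thesis by (auto simp: A'_def space_eq_UNIV)
  qed
  also have "\<dots> \<in> sets M"
  proof -
    have [measurable]: "- A \<in> sets M"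
      using sets.compl_sets[OF assms(1)] by (simp add: space_eq_UNIV Compl_eq_Diff_UNIV)
    show ?thesis by measurable
  qed
  finally have A'[measurable]: "A' \<in> sets M" .
  have shift: "F u x \<in> A'" if "x \<in> A'" for u x
  proof -
    have "AE s in distr lborel borel ((+) u). F s x \<in> A"
      using that unfolding lborel_distr_plus by (simp add: A'_def)
    then have "AE s in lborel. F (u + s) x \<in> A"
      by (rule AE_distrD[rotated]) simp
    moreover have "F (u + s) x = F s (F u x)" for s
      using flow_add[of s u x] by (simp add: add.commute)
    ultimately show ?thesis by (simp add: A'_def)
  qed
  have "F u -` A' = A'" for u
    using shift[of _ u] shift[of "F u _" "- u"] by auto
  then have triv: "measure M A' = 0 \<or> measure M A' = 1"
    by (intro ergodic A')
  have "AE s in lborel. AE x in M. F s x \<in> A \<longleftrightarrow> x \<in> A"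
    using inv by simp
  then have "AE x in M. AE s in lborel. F s x \<in> A \<longleftrightarrow> x \<in> A"
  proof (subst P.AE_commute)
    have "(\<lambda>z. F (snd z) (fst z)) \<in> measurable (M \<Otimes>\<^sub>M lborel) M"
      using flow_swap by (simp add: split_beta')
    note [measurable] = this
    have "Measurable.pred (M \<Otimes>\<^sub>M lborel) (\<lambda>z. (F (snd z) (fst z) \<in> A) = (fst z \<in> A))"
      by measurable
    then show "{z \<in> space (M \<Otimes>\<^sub>M lborel). (F (snd z) (fst z) \<in> A) = (fst z \<in> A)}
        \<in> sets (M \<Otimes>\<^sub>M lborel)"
      unfolding pred_def .
  qed
  then have "AE x in M. x \<in> A' \<longleftrightarrow> x \<in> A"
  proof eventually_elim
    case (elim x)
    show ?case
    proof
      assume "x \<in> A"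
      with elim show "x \<in> A'" by (auto simp: A'_def)
    next
      assume "x \<in> A'"
      then have "AE s in lborel. F s x \<in> A" by (simp add: A'_def)
      with elim have "AE s in (lborel :: real measure). x \<in> A" by eventually_elim simp
      then show "x \<in> A" 
        by (simp add: eventually_const_iff ae_filter_eq_bot_iff)
    qed
  qed
  then have "measure M A' = measure M A"
    by (intro measure_eq_AE) auto
  with triv show ?thesis by simp
qed

text \<open>
  The superlevel set at the mean cannot have measure 1, so it is null, and a function that does not
  exceed its mean equals it.
\<close>

lemma (in ergodic_pmp_flow) AE_invariant_function_constant:
  fixes p :: "'a \<Rightarrow> real"
  assumes p: "integrable M p" and inv: "\<And>s. AE x in M. p (F s x) = p x"
  shows "AE x in M. p x = (\<integral>x. p x \<partial>M)"
proof -
  note [measurable] = borel_measurable_integrable[OF p]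
  define r where "r = (\<integral>x. p x \<partial>M)"
  define A where "A = {x \<in> space M. p x > r}"
  have [measurable]: "A \<in> sets M" unfolding A_def by measurable
  have "measure M A = 0 \<or> measure M A = 1"
  proof (rule AE_invariant_set_trivial)
    show "AE x in M. (F s x \<in> A) = (x \<in> A)" for s
      using inv[of s] by eventually_elim (auto simp: A_def space_eq_UNIV)
  qed measurable
  moreover have "measure M A \<noteq> 1"
  proof
    assume "measure M A = 1"
    then have "AE x in M. r < p x"
      by (subst (asm) prob_eq_1) (auto simp: A_def)
    then have "(\<integral>x. r \<partial>M) < (\<integral>x. p x \<partial>M)"
      using p by (intro integral_less_AE_space) (auto simp: emeasure_space_1)
    then show False by (simp add: r_def prob_space)
  qed
  ultimately have "AE x in M. x \<notin> A"
    by (simp add: prob_eq_0)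
  then have le: "AE x in M. 0 \<le> r - p x" using AE_space by eventually_elim (auto simp: A_def)
  have "(\<integral>x. r - p x \<partial>M) = 0" using p by (simp add: r_def prob_space)
  then have "AE x in M. r - p x = 0"
    using p le by (subst (asm) integral_nonneg_eq_0_iff_AE) auto
  then show ?thesis unfolding r_def by eventually_elim simp
qed

section \<open>Equidistribution of asymptotically invariant sets\<close>

text \<open>
  Domination by a finite measure gives continuity at the empty set, which is what finite additivity
  lacks.
\<close>

lemma dominated_countably_additive:
  fixes m :: "'a set \<Rightarrow> real"
  assumes "finite_measure M"
    and nonneg: "\<And>A. A \<in> sets M \<Longrightarrow> 0 \<le> m A"
    and dom: "\<And>A. A \<in> sets M \<Longrightarrow> m A \<le> measure M A"
    and add: "\<And>A B. A \<in> sets M \<Longrightarrow> B \<in> sets M \<Longrightarrow> A \<inter> B = {} \<Longrightarrow> m (A \<union> B) = m A + m B"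
  shows "countably_additive (sets M) (\<lambda>A. ennreal (m A))"
proof -
  interpret finite_measure M by fact
  have "m {} = 0" using nonneg[of "{}"] dom[of "{}"] by simp
  then have 1: "positive (sets M) (\<lambda>A. ennreal (m A))" by (simp add: positive_def)
  have 2: "additive (sets M) (\<lambda>A. ennreal (m A))"
    by (auto simp: additive_def add nonneg)
  show ?thesis
  proof (rule sets.empty_continuous_imp_countably_additive[OF 1 2])
    fix A :: "nat \<Rightarrow> 'a set" assume A: "range A \<subseteq> sets M" "decseq A" "(\<Inter>i. A i) = {}"
    have "(\<lambda>i. measure M (A i)) \<longlonglongrightarrow> measure M (\<Inter>i. A i)"
      using A by (intro finite_Lim_measure_decseq) auto
    then have "(\<lambda>i. measure M (A i)) \<longlonglongrightarrow> 0" using A by simp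
    then have "(\<lambda>i. m (A i)) \<longlonglongrightarrow> 0"
      by (rule real_tendsto_sandwich[OF _ _ tendsto_const, rotated 2])
         (use A nonneg dom in \<open>auto intro!: always_eventually\<close>)
    then show "(\<lambda>i. ennreal (m (A i))) \<longlonglongrightarrow> 0"
      using tendsto_ennrealI by fastforce
  qed simp
qed

definition asymptotically_invariant ::
  "'a measure \<Rightarrow> (real \<Rightarrow> 'a \<Rightarrow> 'a) \<Rightarrow> (nat \<Rightarrow> 'a set) \<Rightarrow> bool" where
  "asymptotically_invariant M F S \<longleftrightarrow> (\<forall>i. S i \<in> sets M) \<and>
    (\<forall>s. (\<lambda>i. measure M (sym_diff (F s ` S i) (S i))) \<longlonglongrightarrow> 0)"

lemma (in finite_measure) abs_measure_Int_diff_le: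
  assumes [measurable]: "A \<in> sets M" "B \<in> sets M" "C \<in> sets M"
  shows "\<bar>measure M (A \<inter> C) - measure M (B \<inter> C)\<bar> \<le> measure M (sym_diff A B)"
proof -
  have "measure M (A \<inter> C) \<le> measure M (B \<inter> C) + measure M (sym_diff A B)"
    if "A \<in> sets M" "B \<in> sets M" for A B
  proof -
    have "measure M (A \<inter> C) \<le> measure M ((B \<inter> C) \<union> sym_diff A B)"
      using that by (intro finite_measure_mono) auto
    also have "\<dots> \<le> measure M (B \<inter> C) + measure M (sym_diff A B)"
      using that by (intro measure_Un_le) auto
    finally show ?thesis .
  qed
  from this[of A B] this[of B A] show ?thesis by (simp add: Un_commute)
qed

text \<open>
  Any cluster point of the set functions \<open>A \<mapsto> \<mu>(S\<^sub>i \<inter> A)\<close> is a measure dominated by \<open>\<mu>\<close>, and it is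
  invariant because the sets \<open>S\<^sub>i\<close> are asymptotically so. Its density is then an invariant function,
  hence constant, which means that the cluster point is a multiple of \<open>\<mu>\<close>. In other words, the
  indicators of \<open>S\<^sub>i\<close> approach constants in the weak topology.
\<close>

lemma (in ergodic_pmp_flow) asymptotically_invariant_equidistributed:
  assumes S: "asymptotically_invariant M F S" and A: "A \<in> sets M"
  shows "(\<lambda>i. measure M (S i \<inter> A) - measure M (S i) * measure M A) \<longlonglongrightarrow> 0"
proof (rule ccontr)
  assume "\<not> ?thesis"
  then obtain e where e: "e > 0"
    and "\<not> (\<forall>\<^sub>F i in sequentially. norm (measure M (S i \<inter> A) - measure M (S i) * measure M A) < e)"
    by (auto simp: tendsto_iff)
  then have freq: "\<exists>\<^sub>F i in sequentially. norm (measure M (S i \<inter> A) - measure M (S i) * measure M A) \<ge> e"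
    by (simp add: not_eventually not_less)
  \<comment> \<open>The cluster point is taken along the indices where convergence fails, so that its form
    contradicts their choice.\<close>
  define bad where "bad = {i. norm (measure M (S i \<inter> A) - measure M (S i) * measure M A) \<ge> e}"
  define H where "H = inf sequentially (principal bad)"
  have [measurable]: "S i \<in> sets M" for i using S by (simp add: asymptotically_invariant_def)
  have "H \<noteq> bot"
    using freq unfolding H_def frequently_def bad_def
    by (auto simp: trivial_limit_def eventually_inf_principal)
  obtain H' x where H': "H' \<le> H" "H' \<noteq> bot"
    and lim: "\<And>B. ((\<lambda>i. measure M (S i \<inter> B)) \<longlongrightarrow> x B) H'"
    using Tychonoff_cluster[of "\<lambda>i B. measure M (S i \<inter> B)", OF _ \<open>H \<noteq> bot\<close>]
    by (auto simp: prob_le_1)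
  have seq: "H' \<le> sequentially" using H' by (simp add: H_def)
  have nonneg: "0 \<le> x B" for B
    by (rule tendsto_lowerbound[OF lim]) (use H' in auto)
  have le: "x B \<le> measure M B" if "B \<in> sets M" for B
    using H' that by (intro tendsto_upperbound[OF lim]) (auto intro!: always_eventually finite_measure_mono)
  have add: "x (B \<union> C) = x B + x C" if [measurable]: "B \<in> sets M" "C \<in> sets M" and "B \<inter> C = {}" for B C
  proof -
    have "measure M (S i \<inter> (B \<union> C)) = measure M (S i \<inter> B) + measure M (S i \<inter> C)" for i
      using \<open>B \<inter> C = {}\<close>
      by (subst finite_measure_Union[symmetric]) (auto simp: Int_Un_distrib intro!: arg_cong[where f="measure M"])
    then show ?thesis
      using lim[of "B \<union> C"] tendsto_add[OF lim[of B] lim[of C]] H'(2) tendsto_unique by fastforce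
  qed
  have inv: "x (F s -` B) = x B" if B[measurable]: "B \<in> sets M" for s B
  proof -
    \<comment> \<open>Moving the test set is the same as moving \<open>S i\<close>, which changes it little.\<close>
    have "measure M (S i \<inter> F s -` B) = measure M (F s ` S i \<inter> B)" for i
    proof -
      have "F s -` (F s ` S i \<inter> B) = S i \<inter> F s -` B"
        by (auto simp: flow_image_eq_vimage)
      then show ?thesis using measure_flow_vimage[of "F s ` S i \<inter> B" s] by simp
    qed
    then have bd: "norm (measure M (S i \<inter> F s -` B) - measure M (S i \<inter> B))
        \<le> measure M (sym_diff (F s ` S i) (S i))" for i
      using abs_measure_Int_diff_le[of "F s ` S i" "S i" B] by simp
    have "((\<lambda>i. measure M (sym_diff (F s ` S i) (S i))) \<longlongrightarrow> 0) H'"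
      using S seq unfolding asymptotically_invariant_def by (auto intro: tendsto_mono)
    then have "((\<lambda>i. measure M (S i \<inter> F s -` B) - measure M (S i \<inter> B)) \<longlongrightarrow> 0) H'"
      by (rule Lim_null_comparison[OF always_eventually, rotated]) (intro allI bd)
    then show ?thesis
      using tendsto_unique[OF H'(2) tendsto_diff[OF lim[of "F s -` B"] lim[of B]]] by fastforce
  qed
  define m where "m = measure_of UNIV (sets M) (\<lambda>B. ennreal (x B))"
  have sets_m: "sets m = sets M"
    unfolding m_def using sets.sigma_sets_eq[of M] by (simp add: space_eq_UNIV sets_eq_borel)
  have m: "emeasure m B = ennreal (x B)" if "B \<in> sets M" for B
  proof (rule emeasure_measure_of[OF m_def])
    show "sets M \<subseteq> Pow UNIV" by simp
    show "positive (sets m) (\<lambda>B. ennreal (x B))"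
      unfolding sets_m using nonneg le[of "{}"] by (auto simp: positive_def ennreal_eq_0_iff)
    show "countably_additive (sets m) (\<lambda>B. ennreal (x B))"
      unfolding sets_m
      by (rule dominated_countably_additive) (auto simp: nonneg le add finite_measure_axioms)
    show "B \<in> sets m" using that by (simp add: sets_m)
  qed
  obtain p where p[measurable]: "p \<in> borel_measurable M" and p01: "\<And>y. 0 \<le> p y" "\<And>y. p y \<le> 1"
    and mp: "m = density M (\<lambda>y. ennreal (p y))"
  proof (rule bounded_density[of M m 1])
    show "emeasure m B \<le> ennreal 1 * emeasure M B" if "B \<in> sets M" for B
      using that by (simp add: m emeasure_eq_measure le)
  qed (auto simp: sets_m finite_measure_axioms)
  have pint: "integrable M p"
    using p01 by (intro integrable_const_bound[of _ 1]) auto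
  have mint: "ennreal (x B) = (\<integral>\<^sup>+y. ennreal (p y) * indicator B y \<partial>M)" if "B \<in> sets M" for B
    using m[OF that] that unfolding mp by (simp add: emeasure_density)
  have "AE y in M. p y = (\<integral>y. p y \<partial>M)"
  proof (rule AE_invariant_function_constant[OF pint])
    fix s
    have "AE y in M. ennreal (p (F s y)) = ennreal (p y)"
    proof (rule density_unique2)
      fix B assume B[measurable]: "B \<in> sets M"
      have "(\<integral>\<^sup>+y. ennreal (p (F s y)) * indicator B y \<partial>M)
          = (\<integral>\<^sup>+y. ennreal (p (F s y)) * indicator (F (- s) -` B) (F s y) \<partial>M)"
        by (simp add: indicator_def)
      also have "\<dots> = (\<integral>\<^sup>+y. ennreal (p y) * indicator (F (- s) -` B) y \<partial>distr M M (F s))"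
        by (subst nn_integral_distr) auto
      also have "\<dots> = ennreal (x (F (- s) -` B))"
        unfolding measure_preserving by (simp add: mint)
      also have "\<dots> = (\<integral>\<^sup>+y. ennreal (p y) * indicator B y \<partial>M)"
        by (simp add: inv mint)
      finally show "(\<integral>\<^sup>+y. ennreal (p (F s y)) * indicator B y \<partial>M)
        = (\<integral>\<^sup>+y. ennreal (p y) * indicator B y \<partial>M)" .
    qed auto
    then show "AE y in M. p (F s y) = p y"
      by eventually_elim (use p01 in auto)
  qed
  then have const: "x B = (\<integral>y. p y \<partial>M) * measure M B" if [measurable]: "B \<in> sets M" for B
  proof -
    have "ennreal (x B) = (\<integral>\<^sup>+y. ennreal (\<integral>y. p y \<partial>M) * indicator B y \<partial>M)"
      unfolding mint[OF that]
      using \<open>AE y in M. p y = (\<integral>y. p y \<partial>M)\<close>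
      by (intro nn_integral_cong_AE) (auto elim: eventually_mono)
    also have "\<dots> = ennreal ((\<integral>y. p y \<partial>M) * measure M B)"
      using p01 by (simp add: nn_integral_cmult emeasure_eq_measure ennreal_mult)
    finally show ?thesis using p01 nonneg by (subst (asm) ennreal_inj) auto
  qed
  have "x UNIV = (\<integral>y. p y \<partial>M)"
    using const[of UNIV] prob_space sets.top[of M] by (simp add: space_eq_UNIV)
  then have xA: "x A - x UNIV * measure M A = 0" using const[OF A] by simp
  have "((\<lambda>i. measure M (S i \<inter> A) - measure M (S i \<inter> UNIV) * measure M A)
      \<longlongrightarrow> x A - x UNIV * measure M A) H'"
    by (intro tendsto_intros lim)
  then have "\<forall>\<^sub>F i in H'. norm (measure M (S i \<inter> A) - measure M (S i) * measure M A) < e"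
    unfolding xA using e by (auto simp: tendsto_iff)
  moreover have "\<forall>\<^sub>F i in H'. i \<in> bad"
    using H'(1) unfolding H_def by (simp add: le_inf_iff le_principal)
  ultimately have "\<forall>\<^sub>F i in H'. False"
    by eventually_elim (simp add: bad_def)
  then show False using H'(2) by simp
qed

section \<open>Equidistribution in extensions\<close>

text \<open>
  The function \<open>h\<close> is the conditional expectation of \<open>f\<close> given the factor map \<open>\<pi>\<close>, taken as a
  function on the factor itself rather than as a \<open>\<pi>\<close>-measurable function on \<open>L\<close>.
\<close>

lemma pushforward_density:
  assumes "prob_space L" "prob_space M" and \<pi>[measurable]: "\<pi> \<in> measurable L M"
    and marginal: "distr L M \<pi> = M"
    and f[measurable]: "f \<in> borel_measurable L" and f01: "\<And>z. 0 \<le> f z" "\<And>z. f z \<le> (1::real)"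
  obtains h where "h \<in> borel_measurable M" "\<And>x. 0 \<le> h x" "\<And>x. h x \<le> 1"
    "distr (density L (\<lambda>z. ennreal (f z))) M \<pi> = density M (\<lambda>x. ennreal (h x))"
proof -
  interpret M: prob_space M by fact
  show thesis
  proof (rule bounded_density[of M "distr (density L (\<lambda>z. ennreal (f z))) M \<pi>" 1])
    fix A assume A[measurable]: "A \<in> sets M"
    have "emeasure (distr (density L (\<lambda>z. ennreal (f z))) M \<pi>) A
        = (\<integral>\<^sup>+z. ennreal (f z) * indicator (\<pi> -` A \<inter> space L) z \<partial>L)"
      by (simp add: emeasure_distr emeasure_density measurable_sets[OF \<pi>])
    also have "\<dots> \<le> (\<integral>\<^sup>+z. indicator (\<pi> -` A \<inter> space L) z \<partial>L)"
      using f01 by (intro nn_integral_mono) (auto split: split_indicator)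
    also have "\<dots> = emeasure (distr L M \<pi>) A"
      by (simp add: emeasure_distr measurable_sets[OF \<pi>])
    finally show "emeasure (distr (density L (\<lambda>z. ennreal (f z))) M \<pi>) A \<le> ennreal 1 * emeasure M A"
      by (simp add: marginal)
  qed (auto simp: M.finite_measure_axioms that)
qed

lemma integral_pushforward_density:
  fixes k :: "'b \<Rightarrow> 'c::{banach, second_countable_topology}"
  assumes eq: "distr (density L (\<lambda>z. ennreal (f z))) M \<pi> = density M (\<lambda>x. ennreal (h x))"
    and [measurable]: "\<pi> \<in> measurable L M" "f \<in> borel_measurable L" "h \<in> borel_measurable M"
      "k \<in> borel_measurable M"
    and "\<And>z. 0 \<le> f z" "\<And>x. 0 \<le> h x"
  shows "(\<integral>z. f z *\<^sub>R k (\<pi> z) \<partial>L) = (\<integral>x. h x *\<^sub>R k x \<partial>M)"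
proof -
  have "(\<integral>z. f z *\<^sub>R k (\<pi> z) \<partial>L) = (\<integral>z. k (\<pi> z) \<partial>density L (\<lambda>z. ennreal (f z)))"
    by (subst integral_density) (auto simp: assms)
  also have "\<dots> = (\<integral>x. k x \<partial>distr (density L (\<lambda>z. ennreal (f z))) M \<pi>)"
    by (subst integral_distr) auto
  also have "\<dots> = (\<integral>x. h x *\<^sub>R k x \<partial>M)"
    unfolding eq by (subst integral_density) (auto simp: assms)
  finally show ?thesis .
qed

text \<open>
  The functional \<open>\<Psi> \<mapsto> \<integral>\<^bsub>E i\<^esub> \<Psi> - w i \<integral> \<Psi>\<close> is bounded by twice the \<open>L\<^sup>1\<close> norm, uniformly in \<open>i\<close>, so
  convergence for indicators extends to the \<open>L\<^sup>1\<close> closure of their span. With \<open>w = 0\<close> this says that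
  integrals over sets of vanishing measure vanish in the limit.
\<close>

lemma weak_limit_of_indicators:
  fixes \<Psi> :: "'a \<Rightarrow> 'c::{banach, second_countable_topology}"
  assumes "finite_measure L" and E[measurable]: "\<And>i. E i \<in> sets L" and w: "\<And>i. \<bar>w i\<bar> \<le> 1"
    and sets: "\<And>C. C \<in> sets L \<Longrightarrow> (\<lambda>i. measure L (E i \<inter> C) - w i * measure L C) \<longlonglongrightarrow> 0"
    and \<Psi>: "integrable L \<Psi>"
  shows "(\<lambda>i::nat. (\<integral>z. indicator (E i) z *\<^sub>R \<Psi> z \<partial>L) - w i *\<^sub>R (\<integral>z. \<Psi> z \<partial>L)) \<longlonglongrightarrow> 0"
  using \<Psi>
proof induction
  case (base C c)
  interpret finite_measure L by fact
  have [measurable]: "C \<in> sets L" by fact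
  have ind: "(\<integral>z. indicator D z *\<^sub>R c \<partial>L) = measure L D *\<^sub>R c" if "D \<in> sets L" for D
    using integral_scaleR_left[of c L "indicator D"] that
    by (simp add: integrable_indicator_iff less_top[symmetric])
  have "(\<integral>z. indicator (E i) z *\<^sub>R (indicator C z *\<^sub>R c) \<partial>L) = measure L (E i \<inter> C) *\<^sub>R c" for i
  proof -
    have "(\<integral>z. indicator (E i) z *\<^sub>R (indicator C z *\<^sub>R c) \<partial>L)
        = (\<integral>z. indicator (E i \<inter> C) z *\<^sub>R c \<partial>L)"
      by (intro Bochner_Integration.integral_cong) (auto split: split_indicator)
    then show ?thesis by (simp only: ind[OF sets.Int[OF E \<open>C \<in> sets L\<close>]])
  qed
  then have "(\<integral>z. indicator (E i) z *\<^sub>R (indicator C z *\<^sub>R c) \<partial>L)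
      - w i *\<^sub>R (\<integral>z. indicator C z *\<^sub>R c \<partial>L)
    = (measure L (E i \<inter> C) - w i * measure L C) *\<^sub>R c" for i
    unfolding ind[OF \<open>C \<in> sets L\<close>] by (simp add: scaleR_diff_left)
  then show ?case
    using tendsto_scaleR[OF sets[OF \<open>C \<in> sets L\<close>] tendsto_const[of c]] by simp
next
  case (add f g)
  have "(\<integral>z. indicator (E i) z *\<^sub>R (f z + g z) \<partial>L)
      = (\<integral>z. indicator (E i) z *\<^sub>R f z \<partial>L) + (\<integral>z. indicator (E i) z *\<^sub>R g z \<partial>L)" for i
    using add.hyps by (simp add: scaleR_add_right integrable_mult_indicator)
  then show ?case
    using tendsto_add[OF add.IH] add.hyps
    by (simp add: algebra_simps)
next
  case (lim f s)
  note [measurable] = borel_measurable_integrable[OF lim.hyps(1)] borel_measurable_integrable[OF lim.hyps(4)]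
  have l1: "(\<lambda>k. \<integral>z. norm (s k z - f z) \<partial>L) \<longlonglongrightarrow> (\<integral>z. 0 \<partial>L)"
  proof (rule integral_dominated_convergence)
    show "integrable L (\<lambda>z. 3 * norm (f z))" using lim.hyps(4) by simp
    show "AE z in L. (\<lambda>k. norm (s k z - f z)) \<longlonglongrightarrow> 0"
      using lim.hyps(2) by (intro AE_I2) (simp add: LIM_zero_iff tendsto_norm_zero)
    show "AE z in L. norm (norm (s k z - f z)) \<le> 3 * norm (f z)" for k
      using lim.hyps(3)[of _ k] by (intro AE_I2) (smt (verit) norm_triangle_ineq4 real_norm_def norm_ge_zero)
  qed auto
  let ?T = "\<lambda>\<Psi> i. (\<integral>z. indicator (E i) z *\<^sub>R \<Psi> z \<partial>L) - w i *\<^sub>R (\<integral>z. \<Psi> z \<partial>L)"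
  have bound: "norm (?T f i) \<le> norm (?T (s k) i) + 2 * (\<integral>z. norm (s k z - f z) \<partial>L)" for i k
  proof -
    have int: "integrable L (\<lambda>z. f z - s k z)" using lim.hyps by simp
    have "?T f i - ?T (s k) i = (\<integral>z. indicator (E i) z *\<^sub>R (f z - s k z) \<partial>L) - w i *\<^sub>R (\<integral>z. f z - s k z \<partial>L)"
      using lim.hyps(1,4) by (simp add: scaleR_diff_right integrable_mult_indicator)
    also have "norm \<dots> \<le> norm (\<integral>z. indicator (E i) z *\<^sub>R (f z - s k z) \<partial>L) + norm (w i *\<^sub>R (\<integral>z. f z - s k z \<partial>L))"
      by (rule norm_triangle_ineq4)
    also have "norm (\<integral>z. indicator (E i) z *\<^sub>R (f z - s k z) \<partial>L) \<le> (\<integral>z. norm (s k z - f z) \<partial>L)"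
    proof (rule order_trans[OF integral_norm_bound integral_mono])
      show "integrable L (\<lambda>z. norm (indicator (E i) z *\<^sub>R (f z - s k z)))"
        using int by (intro integrable_norm integrable_mult_indicator) auto
      show "integrable L (\<lambda>z. norm (s k z - f z))"
        using integrable_norm[OF int] by (simp add: norm_minus_commute)
    qed (auto simp: norm_minus_commute split: split_indicator)
    also have "norm (w i *\<^sub>R (\<integral>z. f z - s k z \<partial>L)) \<le> 1 * (\<integral>z. norm (s k z - f z) \<partial>L)"
      unfolding norm_scaleR
    proof (intro mult_mono)
      show "norm (\<integral>z. f z - s k z \<partial>L) \<le> (\<integral>z. norm (s k z - f z) \<partial>L)"
        using integral_norm_bound[of L "\<lambda>z. f z - s k z"] by (simp add: norm_minus_commute)
    qed (use w[of i] in auto)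
    finally show ?thesis
      using norm_triangle_ineq2[of "?T f i" "?T (s k) i"] by linarith
  qed
  show ?case
  proof (rule LIMSEQ_I)
    fix e :: real assume "e > 0"
    then obtain k where k: "norm ((\<integral>z. norm (s k z - f z) \<partial>L)) < e / 4"
      using LIMSEQ_D[OF l1, of "e / 4"] by auto
    obtain n where n: "norm (?T (s k) i) < e / 2" if "i \<ge> n" for i
      using LIMSEQ_D[OF lim.IH[of k], of "e / 2"] \<open>e > 0\<close> by auto
    show "\<exists>n. \<forall>i\<ge>n. norm (?T f i - 0) < e"
    proof (intro exI allI impI)
      fix i assume "n \<le> i"
      with n[of i] k bound[of i k] show "norm (?T f i - 0) < e" by simp
    qed
  qed
qed

text \<open>
  Tested against a set \<open>C\<close> of the extension \<open>L\<close>, the pulled back indicator of \<open>S\<^sub>i\<close> only sees the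
  conditional probability of \<open>C\<close> given the factor, which is a fixed function on \<open>M\<close>.
\<close>

lemma (in ergodic_pmp_flow) asymptotically_invariant_equidistributed_extension:
  fixes \<Psi> :: "'z \<Rightarrow> 'c::{banach, second_countable_topology}"
  assumes S: "asymptotically_invariant M F S"
    and "prob_space L" and \<pi>[measurable]: "\<pi> \<in> measurable L M" and marginal: "distr L M \<pi> = M"
    and \<Psi>: "integrable L \<Psi>"
  shows "(\<lambda>i. (\<integral>z. indicator (S i) (\<pi> z) *\<^sub>R \<Psi> z \<partial>L) - measure M (S i) *\<^sub>R (\<integral>z. \<Psi> z \<partial>L)) \<longlonglongrightarrow> 0"
proof -
  interpret L: prob_space L by fact
  have [measurable]: "S i \<in> sets M" for i using S by (simp add: asymptotically_invariant_def)
  define E where "E i = \<pi> -` S i \<inter> space L" for i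
  have [measurable]: "E i \<in> sets L" for i unfolding E_def by measurable
  have "(\<lambda>i. (\<integral>z. indicator (E i) z *\<^sub>R \<Psi> z \<partial>L) - measure M (S i) *\<^sub>R (\<integral>z. \<Psi> z \<partial>L)) \<longlonglongrightarrow> 0"
  proof (rule weak_limit_of_indicators[OF L.finite_measure_axioms _ _ _ \<Psi>])
    fix C assume C[measurable]: "C \<in> sets L"
    obtain h where h[measurable]: "h \<in> borel_measurable M" "\<And>x. 0 \<le> h x" "\<And>x. h x \<le> 1"
      and hC: "distr (density L (\<lambda>z. ennreal (indicator C z))) M \<pi> = density M (\<lambda>x. ennreal (h x))"
      by (rule pushforward_density[OF \<open>prob_space L\<close> prob_space_axioms \<pi> marginal, of "indicator C"])
         (auto split: split_indicator)
    note hint = integral_pushforward_density[OF hC]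
    have 1: "(\<integral>x. indicator (S i) x *\<^sub>R h x \<partial>M) = measure L (E i \<inter> C)" for i
    proof -
      have "measure L (E i \<inter> C) = (\<integral>z. indicator C z *\<^sub>R indicator (S i) (\<pi> z) \<partial>L)"
      proof -
        have "measure L (E i \<inter> C) = (\<integral>z. indicator (E i \<inter> C) z \<partial>L)" by simp
        also have "\<dots> = (\<integral>z. indicator C z *\<^sub>R indicator (S i) (\<pi> z) \<partial>L)"
          by (intro Bochner_Integration.integral_cong) (auto simp: E_def split: split_indicator)
        finally show ?thesis .
      qed
      then show ?thesis
        using h by (subst (asm) hint) (auto simp: mult.commute)
    qed
    have 2: "(\<integral>x. h x \<partial>M) = measure L C"
      using hint[of "\<lambda>_. 1::real"] h by simp
    have "integrable M h" using h by (intro integrable_const_bound[of _ 1]) auto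
    then have "(\<lambda>i. (\<integral>x. indicator (S i) x *\<^sub>R h x \<partial>M) - measure M (S i) *\<^sub>R (\<integral>x. h x \<partial>M)) \<longlonglongrightarrow> 0"
      by (intro weak_limit_of_indicators asymptotically_invariant_equidistributed[OF S])
         (simp_all add: finite_measure_axioms)
    then show "(\<lambda>i. measure L (E i \<inter> C) - measure M (S i) * measure L C) \<longlonglongrightarrow> 0"
      unfolding 1 2 by simp
  qed simp_all
  moreover have "(\<integral>z. indicator (E i) z *\<^sub>R \<Psi> z \<partial>L) = (\<integral>z. indicator (S i) (\<pi> z) *\<^sub>R \<Psi> z \<partial>L)" for i
    by (intro Bochner_Integration.integral_cong) (auto simp: E_def split: split_indicator)
  ultimately show ?thesis by simp
qed

section \<open>Partial rigidity for measurable sets\<close>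

lemma (in pmp_flow)
  fixes f :: "'a \<Rightarrow> 'c::{banach, second_countable_topology}"
  shows integral_flow: "f \<in> borel_measurable M \<Longrightarrow> (\<integral>x. f (F s x) \<partial>M) = (\<integral>x. f x \<partial>M)"
    and integrable_flow: "integrable M f \<Longrightarrow> integrable M (\<lambda>x. f (F s x))"
proof -
  show "(\<integral>x. f (F s x) \<partial>M) = (\<integral>x. f x \<partial>M)" if [measurable]: "f \<in> borel_measurable M"
    using integral_distr[of "F s" M M f] measure_preserving[of s] by simp
  show "integrable M (\<lambda>x. f (F s x))" if f: "integrable M f"
    by (rule integrable_distr[OF measurable_flow_map]) (simp add: measure_preserving f)
qed

text \<open>
  For \<open>f\<close> the indicator of \<open>A\<close> this is the measure of the points of \<open>E\<close> that enter or leave \<open>A\<close>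
  at time \<open>s\<close>.
\<close>

definition displacement ::
  "'a measure \<Rightarrow> (real \<Rightarrow> 'a \<Rightarrow> 'a) \<Rightarrow> real \<Rightarrow> 'a set \<Rightarrow> ('a \<Rightarrow> real) \<Rightarrow> real" where
  "displacement M F s E f = (\<integral>x. indicator E x * \<bar>f (F s x) - f x\<bar> \<partial>M)"

lemma (in pmp_flow) displacement_le:
  assumes f: "integrable M f" and g: "integrable M g" and [measurable]: "E \<in> sets M"
  shows "displacement M F s E f \<le> displacement M F s E g + 2 * (\<integral>x. \<bar>f x - g x\<bar> \<partial>M)"
proof -
  note [measurable] = borel_measurable_integrable[OF f] borel_measurable_integrable[OF g]
  have fs: "integrable M (\<lambda>x. f (F s x))" and gs: "integrable M (\<lambda>x. g (F s x))"
    using f g by (auto intro: integrable_flow)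
  have ind: "integrable M (\<lambda>x. indicator E x * k x)" if "integrable M k" for k :: "'a \<Rightarrow> real"
    using integrable_mult_indicator[OF _ that, of E] by simp
  have fg: "integrable M (\<lambda>x. \<bar>f (F s x) - g (F s x)\<bar>)" using fs gs by simp
  have "displacement M F s E f \<le> (\<integral>x. indicator E x * \<bar>g (F s x) - g x\<bar> + (\<bar>f (F s x) - g (F s x)\<bar> + \<bar>f x - g x\<bar>) \<partial>M)"
    unfolding displacement_def
    using f g fs gs fg by (intro integral_mono) (auto intro!: ind split: split_indicator)
  also have "\<dots> = displacement M F s E g + ((\<integral>x. \<bar>f (F s x) - g (F s x)\<bar> \<partial>M) + (\<integral>x. \<bar>f x - g x\<bar> \<partial>M))"
    unfolding displacement_def
    using f g fs gs fg by (subst Bochner_Integration.integral_add) (auto intro!: ind)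
  also have "(\<integral>x. \<bar>f (F s x) - g (F s x)\<bar> \<partial>M) = (\<integral>x. \<bar>f x - g x\<bar> \<partial>M)"
    using integral_flow[of "\<lambda>x. \<bar>f x - g x\<bar>" s] by simp
  finally show ?thesis by simp
qed

lemma displacement_nonneg: "0 \<le> displacement M F s E f"
  unfolding displacement_def by (intro Bochner_Integration.integral_nonneg) auto

lemma (in pmp_flow) displacement_tendsto_0_L1_closure:
  assumes f: "integrable M f" and E: "\<And>i. E i \<in> sets M"
    and approx: "\<And>e. e > 0 \<Longrightarrow> \<exists>g. integrable M g \<and> (\<integral>x. \<bar>f x - g x\<bar> \<partial>M) < e \<and>
      (\<lambda>i. displacement M F (t i) (E i) g) \<longlonglongrightarrow> 0"
  shows "(\<lambda>i::nat. displacement M F (t i) (E i) f) \<longlonglongrightarrow> 0"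
proof (rule LIMSEQ_I)
  fix e :: real assume "e > 0"
  then obtain g where g: "integrable M g" "(\<integral>x. \<bar>f x - g x\<bar> \<partial>M) < e / 4"
    and lim: "(\<lambda>i. displacement M F (t i) (E i) g) \<longlonglongrightarrow> 0"
    using approx[of "e / 4"] by auto
  obtain n where n: "norm (displacement M F (t i) (E i) g) < e / 2" if "i \<ge> n" for i
    using LIMSEQ_D[OF lim, of "e / 2"] \<open>e > 0\<close> by auto
  show "\<exists>n. \<forall>i\<ge>n. norm (displacement M F (t i) (E i) f - 0) < e"
  proof (intro exI allI impI)
    fix i assume "n \<le> i"
    with n[of i] g displacement_le[OF f g(1) E, of "t i" i]
      displacement_nonneg[of M F "t i" "E i" f]
    show "norm (displacement M F (t i) (E i) f - 0) < e" by simp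
  qed
qed

text \<open>
  On a Lipschitz function the displacement is controlled by the distance moved. Closed sets are
  \<open>L\<^sup>1\<close> limits of Lipschitz functions, and the sets for which it tends to 0 form a Dynkin
  system. Henceforth rigidity is a statement about measurable sets, free of the metric.
\<close>

lemma partial_rigidity_moves_sets_little:
  fixes M :: "'a::{metric_space, second_countable_topology} measure"
  assumes "pmp_flow M F" and S[measurable]: "\<And>i. S i \<in> sets M"
    and rigid: "(\<lambda>i::nat. \<integral>\<^sup>+x\<in>S i. ennreal (dist (F (t i) x) x) \<partial>M) \<longlonglongrightarrow> 0"
    and A: "A \<in> sets M"
  shows "(\<lambda>i. displacement M F (t i) (S i) (indicator A)) \<longlonglongrightarrow> 0"
proof -
  interpret pmp_flow M F by fact
  have intI: "integrable M f" if "f \<in> borel_measurable M" "\<And>x. 0 \<le> f x" "\<And>x. f x \<le> 1" for f :: "'a \<Rightarrow> real"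
    using that by (intro integrable_const_bound[of _ 1]) auto
  have lip: "(\<lambda>i. displacement M F (t i) (S i) f) \<longlonglongrightarrow> 0"
    if f[measurable]: "f \<in> borel_measurable M" "\<And>x. 0 \<le> f x" "\<And>x. f x \<le> 1"
      and "K \<ge> 0" and K: "\<And>x y. \<bar>f x - f y\<bar> \<le> K * dist x y" for f K
  proof -
    have le: "ennreal (displacement M F (t i) (S i) f)
        \<le> ennreal K * (\<integral>\<^sup>+x\<in>S i. ennreal (dist (F (t i) x) x) \<partial>M)" for i
    proof -
      have "ennreal (displacement M F (t i) (S i) f)
          = (\<integral>\<^sup>+x. ennreal (indicator (S i) x * \<bar>f (F (t i) x) - f x\<bar>) \<partial>M)"
        unfolding displacement_def
      proof (rule nn_integral_eq_integral[symmetric])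
        show "integrable M (\<lambda>x. indicator (S i) x * \<bar>f (F (t i) x) - f x\<bar>)"
        proof (intro intI)
          show "indicator (S i) x * \<bar>f (F (t i) x) - f x\<bar> \<le> 1" for x
            using f(2)[of x] f(3)[of x] f(2)[of "F (t i) x"] f(3)[of "F (t i) x"]
            by (auto split: split_indicator)
        qed auto
      qed auto
      also have "\<dots> \<le> (\<integral>\<^sup>+x. ennreal K * (ennreal (dist (F (t i) x) x) * indicator (S i) x) \<partial>M)"
        using K \<open>K \<ge> 0\<close> by (intro nn_integral_mono) (auto split: split_indicator simp flip: ennreal_mult)
      also have "\<dots> = ennreal K * (\<integral>\<^sup>+x\<in>S i. ennreal (dist (F (t i) x) x) \<partial>M)"
      proof (rule nn_integral_cmult)
        have [measurable]: "F (t i) \<in> borel_measurable M"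
          using measurable_flow_map[of "t i"] measurable_cong_sets[OF refl sets_eq_borel, of M] by blast
        have [measurable]: "(\<lambda>x. x) \<in> borel_measurable M"
          using sets_eq_borel by (simp add: measurable_ident_sets)
        show "(\<lambda>x. ennreal (dist (F (t i) x) x) * indicator (S i) x) \<in> borel_measurable M"
          by measurable
      qed
      finally show ?thesis .
    qed
    have "(\<lambda>i. ennreal K * (\<integral>\<^sup>+x\<in>S i. ennreal (dist (F (t i) x) x) \<partial>M)) \<longlonglongrightarrow> 0"
      using ennreal_tendsto_cmult[OF _ rigid, of "ennreal K"] by simp
    then have "(\<lambda>i. ennreal (displacement M F (t i) (S i) f)) \<longlonglongrightarrow> ennreal 0"
      unfolding ennreal_0
      by (rule tendsto_sandwich[OF always_eventually always_eventually tendsto_const, rotated 2])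
         (use le in auto)
    then show ?thesis
      by (subst (asm) tendsto_ennreal_iff) (auto simp: displacement_nonneg)
  qed
  have closed: "(\<lambda>i. displacement M F (t i) (S i) (indicator C)) \<longlonglongrightarrow> 0" if "closed C" for C
  \<comment> \<open>The empty set is special because the distance to it is 0 by convention.\<close>
  proof (cases "C = {}")
    case True
    then show ?thesis by (simp add: displacement_def)
  next
    case False
    define g where "g n x = max 0 (1 - real n * infdist x C)" for n x
    have cont: "continuous_on UNIV (g n)" for n
      unfolding g_def by (intro continuous_intros)
    have [measurable]: "g n \<in> borel_measurable M" for n
      using borel_measurable_continuous_onI[OF cont] measurable_cong_sets[OF sets_eq_borel refl] by blast
    have [measurable]: "C \<in> sets M" using \<open>closed C\<close> by (simp add: sets_eq_borel)
    have g: "0 \<le> g n x" "g n x \<le> 1" for n x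
      by (auto simp: g_def infdist_nonneg)
    have "(\<lambda>n. g n x) \<longlonglongrightarrow> indicator C x" for x
    proof (cases "x \<in> C")
      case True
      then show ?thesis by (simp add: g_def)
    next
      case False
      then have pos: "infdist x C > 0"
        using \<open>closed C\<close> \<open>C \<noteq> {}\<close> infdist_pos_not_in_closed by blast
      obtain n0 :: nat where n0: "1 / infdist x C < real n0" using reals_Archimedean2 by blast
      have "g n x = 0" if "n \<ge> n0" for n
      proof -
        have "1 / infdist x C \<le> real n" using n0 that by linarith
        then have "1 \<le> real n * infdist x C" using pos by (simp add: field_simps)
        then show ?thesis by (simp add: g_def)
      qed
      then have "\<forall>\<^sub>F n in sequentially. g n x = 0"
        by (auto simp: eventually_sequentially)
      then show ?thesis using False by (simp add: tendsto_eventually)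
    qed
    note lim = this
    have "(\<lambda>n. \<integral>x. \<bar>indicator C x - g n x\<bar> \<partial>M) \<longlonglongrightarrow> (\<integral>x. \<bar>indicator C x - indicator C x\<bar> \<partial>M)"
    proof (rule integral_dominated_convergence[where w="\<lambda>_. 1"])
      show "AE x in M. (\<lambda>n. \<bar>indicator C x - g n x\<bar>) \<longlonglongrightarrow> \<bar>indicator C x - indicator C x\<bar>"
        by (intro always_eventually allI tendsto_intros lim)
      show "AE x in M. norm \<bar>indicator C x - g n x\<bar> \<le> 1" for n
      proof (intro always_eventually allI)
        show "norm \<bar>indicator C x - g n x\<bar> \<le> 1" for x
          using g[of n x] by (auto split: split_indicator)
      qed
    qed auto
    then have l1: "(\<lambda>n. \<integral>x. \<bar>indicator C x - g n x\<bar> \<partial>M) \<longlonglongrightarrow> 0" by simp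
    show ?thesis
    proof (rule displacement_tendsto_0_L1_closure)
      fix e :: real assume "e > 0"
      from LIMSEQ_D[OF l1 this] obtain n where n: "(\<integral>x. \<bar>indicator C x - g n x\<bar> \<partial>M) < e"
        by fastforce
      have "\<bar>g n x - g n y\<bar> \<le> real n * dist x y" for x y
      proof -
        have "\<bar>g n x - g n y\<bar> \<le> \<bar>real n * infdist x C - real n * infdist y C\<bar>"
          unfolding g_def by linarith
        also have "\<dots> = real n * \<bar>infdist x C - infdist y C\<bar>"
          by (simp add: abs_mult flip: right_diff_distrib)
        also have "\<dots> \<le> real n * dist x y"
          using infdist_triangle[of x C y] infdist_triangle[of y C x] 
          by (intro mult_left_mono) (auto simp: dist_commute abs_le_iff)
        finally show ?thesis .
      qed
      then show "\<exists>g. integrable M g \<and> (\<integral>x. \<bar>indicator C x - g x\<bar> \<partial>M) < e \<and>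
          (\<lambda>i. displacement M F (t i) (S i) g) \<longlonglongrightarrow> 0"
        using n g by (intro exI[of _ "g n"] conjI intI lip[of _ "real n"]) auto
    qed (auto intro!: intI split: split_indicator)
  qed
  have "Int_stable (Collect closed :: 'a set set)" "Collect closed \<subseteq> Pow (UNIV :: 'a set)"
    "A \<in> sigma_sets UNIV (Collect closed)"
    using A by (auto simp: sets_eq_borel borel_eq_closed Int_stable_def)
  then show ?thesis
  proof (induction rule: sigma_sets_induct_disjoint)
    case (basic C)
    then show ?case using closed by simp
  next
    case empty
    show ?case by (simp add: displacement_def)
  next
    case (compl B)
    have "displacement M F s T (indicator (UNIV - B)) = displacement M F s T (indicator B)" for s T
      unfolding displacement_def
      by (intro Bochner_Integration.integral_cong) (auto split: split_indicator)
    then show ?case using compl by simp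
  next
    case (union B)
    have B[measurable]: "B n \<in> sets M" for n
      using union(2)[unfolded image_subset_iff] by (simp add: sets_eq_borel borel_eq_closed)
    have fin: "(\<lambda>i. displacement M F (t i) (S i) (indicator (\<Union>j<n. B j))) \<longlonglongrightarrow> 0" for n
    proof (rule Lim_null_comparison[OF always_eventually], intro allI)
      have ind: "indicator (\<Union>j<n. B j) x = (\<Sum>j<n. indicator (B j) x :: real)" for x
        using union(1) by (intro indicator_UN_disjoint) (auto intro: disjoint_family_on_mono)
      fix i
      have "displacement M F (t i) (S i) (indicator (\<Union>j<n. B j))
          \<le> (\<integral>x. (\<Sum>j<n. indicator (S i) x * \<bar>indicator (B j) (F (t i) x) - indicator (B j) x\<bar>) \<partial>M)"
        unfolding displacement_def
      proof (intro integral_mono)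
        fix x
        have "\<bar>indicator (\<Union>j<n. B j) (F (t i) x) - indicator (\<Union>j<n. B j) x\<bar>
            \<le> (\<Sum>j<n. \<bar>indicator (B j) (F (t i) x) - indicator (B j) x\<bar> :: real)"
          unfolding ind by (simp add: sum_subtractf[symmetric] sum_abs)
        then show "indicator (S i) x * \<bar>indicator (\<Union>j<n. B j) (F (t i) x) - indicator (\<Union>j<n. B j) x\<bar>
            \<le> (\<Sum>j<n. indicator (S i) x * \<bar>indicator (B j) (F (t i) x) - indicator (B j) x\<bar> :: real)"
          by (auto simp: sum_distrib_left[symmetric] split: split_indicator)
      next
        show "integrable M (\<lambda>x. indicator (S i) x * \<bar>indicator (\<Union>j<n. B j) (F (t i) x) - indicator (\<Union>j<n. B j) x\<bar> :: real)"
          by (intro intI) (measurable, auto split: split_indicator)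
        show "integrable M (\<lambda>x. \<Sum>j<n. indicator (S i) x * \<bar>indicator (B j) (F (t i) x) - indicator (B j) x\<bar> :: real)"
          by (intro Bochner_Integration.integrable_sum intI) (measurable, auto split: split_indicator)
      qed
      also have "\<dots> = (\<Sum>j<n. displacement M F (t i) (S i) (indicator (B j)))"
        unfolding displacement_def
        by (intro Bochner_Integration.integral_sum intI) (measurable, auto split: split_indicator)
      finally show "norm (displacement M F (t i) (S i) (indicator (\<Union>j<n. B j)))
          \<le> (\<Sum>j<n. displacement M F (t i) (S i) (indicator (B j)))"
        by (simp add: displacement_nonneg)
    next
      show "(\<lambda>i. \<Sum>j<n. displacement M F (t i) (S i) (indicator (B j))) \<longlonglongrightarrow> 0"
        using union(3) by (intro tendsto_null_sum) auto
    qed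
    have "(\<lambda>n. \<integral>x. \<bar>indicator (\<Union>j. B j) x - indicator (\<Union>j<n. B j) x\<bar> \<partial>M)
        \<longlonglongrightarrow> (\<integral>x. \<bar>indicator (\<Union>j. B j) x - indicator (\<Union>j. B j) x :: real\<bar> \<partial>M)"
    proof (rule integral_dominated_convergence[where w="\<lambda>_. 1"])
      show "AE x in M. (\<lambda>n. \<bar>indicator (\<Union>j. B j) x - indicator (\<Union>j<n. B j) x :: real\<bar>)
          \<longlonglongrightarrow> \<bar>indicator (\<Union>j. B j) x - indicator (\<Union>j. B j) x\<bar>"
        by (intro always_eventually allI tendsto_intros LIMSEQ_indicator_UN)
    qed (auto split: split_indicator)
    then have l1: "(\<lambda>n. \<integral>x. \<bar>indicator (\<Union>j. B j) x - indicator (\<Union>j<n. B j) x :: real\<bar> \<partial>M) \<longlonglongrightarrow> 0"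
      by simp
    show ?case
    proof (rule displacement_tendsto_0_L1_closure)
      fix e :: real assume "e > 0"
      from LIMSEQ_D[OF l1 this] obtain n
        where n: "(\<integral>x. \<bar>indicator (\<Union>j. B j) x - indicator (\<Union>j<n. B j) x :: real\<bar> \<partial>M) < e"
        by fastforce
      then show "\<exists>g. integrable M g \<and> (\<integral>x. \<bar>indicator (\<Union>j. B j) x - g x\<bar> \<partial>M) < e \<and>
          (\<lambda>i. displacement M F (t i) (S i) g) \<longlonglongrightarrow> 0"
        by (intro exI[of _ "indicator (\<Union>j<n. B j)"] conjI intI fin) (auto split: split_indicator)
    qed (auto intro!: intI split: split_indicator)
  qed
qed

section \<open>Square integrable functions\<close>

lemma (in prob_space) integrable_bounded:
  fixes f :: "'a \<Rightarrow> 'c::{banach, second_countable_topology}"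
  shows "f \<in> borel_measurable M \<Longrightarrow> (\<And>x. norm (f x) \<le> K) \<Longrightarrow> integrable M f"
  by (intro integrable_const_bound[of _ K]) auto

lemma (in prob_space) square_integrable_imp_integrable:
  assumes "f \<in> square_integrable M"
  shows "integrable M f"
proof (rule Bochner_Integration.integrable_bound)
  show "integrable M (\<lambda>x. 1 + (cmod (f x))\<^sup>2)"
    using assms by (simp add: square_integrable_def)
  show "AE x in M. norm (f x) \<le> norm (1 + (cmod (f x))\<^sup>2)"
  proof (rule AE_I2)
    fix x
    have "2 * cmod (f x) \<le> 1 + (cmod (f x))\<^sup>2" "0 \<le> cmod (f x)"
      using sum_squares_bound[of 1 "cmod (f x)"] by simp_all
    then show "norm (f x) \<le> norm (1 + (cmod (f x))\<^sup>2)"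
      unfolding real_norm_def by linarith
  qed
qed (use assms in \<open>simp add: square_integrable_def\<close>)

lemma square_integrable_add:
  assumes "f \<in> square_integrable M" "g \<in> square_integrable M"
  shows "(\<lambda>x. f x + g x) \<in> square_integrable M"
proof -
  note [measurable] = assms[unfolded square_integrable_def, simplified, THEN conjunct1]
  have "integrable M (\<lambda>x. 2 * (cmod (f x))\<^sup>2 + 2 * (cmod (g x))\<^sup>2)"
    using assms by (simp add: square_integrable_def)
  then have "integrable M (\<lambda>x. (cmod (f x + g x))\<^sup>2)"
  proof (rule Bochner_Integration.integrable_bound)
    have "(cmod (f x + g x))\<^sup>2 \<le> 2 * (cmod (f x))\<^sup>2 + 2 * (cmod (g x))\<^sup>2" for x
    proof -
      have "(cmod (f x + g x))\<^sup>2 \<le> (cmod (f x) + cmod (g x))\<^sup>2"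
        by (intro power_mono norm_triangle_ineq) simp
      also have "\<dots> \<le> 2 * (cmod (f x))\<^sup>2 + 2 * (cmod (g x))\<^sup>2"
        using sum_squares_bound[of "cmod (f x)" "cmod (g x)"] by (simp add: power2_sum)
      finally show ?thesis .
    qed
    then show "AE x in M. norm ((cmod (f x + g x))\<^sup>2) \<le> norm (2 * (cmod (f x))\<^sup>2 + 2 * (cmod (g x))\<^sup>2)"
      by (intro AE_I2) simp
  qed measurable
  then show ?thesis by (simp add: square_integrable_def)
qed

lemma square_integrable_cmult:
  "f \<in> square_integrable M \<Longrightarrow> (\<lambda>x. a * f x) \<in> square_integrable M"
  by (auto simp: square_integrable_def norm_mult power_mult_distrib)

lemma square_integrable_sum:
  "(\<And>k. k < n \<Longrightarrow> f k \<in> square_integrable M) \<Longrightarrow> (\<lambda>x. \<Sum>k<n::nat. f k x) \<in> square_integrable M"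
proof (induction n)
  case 0
  show ?case by (simp add: square_integrable_def)
next
  case (Suc n)
  then show ?case by (simp add: square_integrable_add)
qed


section \<open>Joinings with a partially rigid flow\<close>

lemma (in pmp_flow) asymptotically_invariant_flow_image:
  assumes S: "asymptotically_invariant M F S"
  shows "asymptotically_invariant M F (\<lambda>i. F (t i) ` S i)"
  unfolding asymptotically_invariant_def
proof (intro conjI allI)
  have [measurable]: "S i \<in> sets M" for i using S by (simp add: asymptotically_invariant_def)
  show "F (t i) ` S i \<in> sets M" for i by measurable
  fix s
  have "measure M (sym_diff (F s ` F (t i) ` S i) (F (t i) ` S i)) = measure M (sym_diff (F s ` S i) (S i))" for i
  proof -
    have "inj (F (t i))" by (rule inj_on_inverseI[of _ "F (- t i)"]) simp
    moreover have "F s ` F (t i) ` S i = F (t i) ` F s ` S i"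
      unfolding image_image by (simp add: add.commute flip: flow_add)
    ultimately have "sym_diff (F s ` F (t i) ` S i) (F (t i) ` S i) = F (t i) ` sym_diff (F s ` S i) (S i)"
      by (simp add: image_Un image_set_diff)
    then show ?thesis by (simp add: measure_flow_image)
  qed
  then show "(\<lambda>i. measure M (sym_diff (F s ` F (t i) ` S i) (F (t i) ` S i))) \<longlonglongrightarrow> 0"
    using S by (simp add: asymptotically_invariant_def)
qed

locale flow_joining = X: ergodic_pmp_flow M F + Y: pmp_flow N G + L: prob_space L
  for M :: "'a::second_countable_topology measure" and F
    and N :: "'b::second_countable_topology measure" and G
    and L :: "('a \<times> 'b) measure" +
  assumes sets_L: "sets L = sets (M \<Otimes>\<^sub>M N)"
    and fst_marginal: "distr L M fst = M" and snd_marginal: "distr L N snd = N"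
    and L_preserving: "distr L L (map_prod (F s) (G s)) = L"
begin

lemma measurable_L_fst [measurable]: "fst \<in> measurable L M"
  and measurable_L_snd [measurable]: "snd \<in> measurable L N"
  using measurable_fst measurable_snd measurable_cong_sets[OF sets_L refl] by blast+

lemma measurable_L_flow [measurable]: "map_prod (F s) (G s) \<in> measurable L L"
proof -
  have "map_prod (F s) (G s) \<in> measurable (M \<Otimes>\<^sub>M N) (M \<Otimes>\<^sub>M N)"
    by (simp add: map_prod_def split_beta')
  then show ?thesis using measurable_cong_sets[OF sets_L sets_L] by blast
qed

lemma integral_L_flow:
  fixes \<Psi> :: "'a \<times> 'b \<Rightarrow> 'c::{banach, second_countable_topology}"
  assumes "\<Psi> \<in> borel_measurable L"
  shows "(\<integral>z. \<Psi> (F s (fst z), G s (snd z)) \<partial>L) = (\<integral>z. \<Psi> z \<partial>L)"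
proof -
  have eq: "map_prod (F s) (G s) z = (F s (fst z), G s (snd z))" for z
    by (cases z) simp
  show ?thesis
    using integral_distr[OF measurable_L_flow assms, of s] L_preserving[of s] by (simp add: eq)
qed

lemma
  fixes k :: "'b \<Rightarrow> 'c::{banach, second_countable_topology}"
  shows integral_L_snd: "k \<in> borel_measurable N \<Longrightarrow> (\<integral>z. k (snd z) \<partial>L) = (\<integral>y. k y \<partial>N)"
    and integrable_L_snd: "integrable N k \<Longrightarrow> integrable L (\<lambda>z. k (snd z))"
proof -
  show "(\<integral>z. k (snd z) \<partial>L) = (\<integral>y. k y \<partial>N)" if "k \<in> borel_measurable N"
    using integral_distr[OF measurable_L_snd that] snd_marginal by simp
  show "integrable L (\<lambda>z. k (snd z))" if "integrable N k"
    using integrable_distr[OF measurable_L_snd, of k] snd_marginal that by simp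
qed

lemma integral_L_fst:
  fixes k :: "'a \<Rightarrow> 'c::{banach, second_countable_topology}"
  shows "k \<in> borel_measurable M \<Longrightarrow> (\<integral>z. k (fst z) \<partial>L) = (\<integral>x. k x \<partial>M)"
  using integral_distr[OF measurable_L_fst, of k] fst_marginal by simp

lemma AE_L_snd: "AE y in N. P y \<Longrightarrow> AE z in L. P (snd z)"
  by (rule AE_distrD[OF measurable_L_snd]) (unfold snd_marginal)

text \<open>
  The second limit is the first one for the sets \<open>F\<^sup>t S\<^sub>i\<close>, transported back by the invariance of the
  joining.
\<close>

lemma averages_over_asymptotically_invariant:
  fixes \<Psi> :: "'a \<times> 'b \<Rightarrow> 'c::{banach, second_countable_topology}"
  assumes S: "asymptotically_invariant M F S" and \<Psi>: "integrable L \<Psi>"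
  shows "(\<lambda>i. (\<integral>z. indicator (S i) (fst z) *\<^sub>R \<Psi> z \<partial>L) - measure M (S i) *\<^sub>R (\<integral>z. \<Psi> z \<partial>L)) \<longlonglongrightarrow> 0"
    and "(\<lambda>i. (\<integral>z. indicator (S i) (fst z) *\<^sub>R \<Psi> (F (t i) (fst z), G (t i) (snd z)) \<partial>L)
        - measure M (S i) *\<^sub>R (\<integral>z. \<Psi> z \<partial>L)) \<longlonglongrightarrow> 0"
proof -
  note ext = X.asymptotically_invariant_equidistributed_extension[OF _ L.prob_space_axioms measurable_L_fst fst_marginal \<Psi>]
  show "(\<lambda>i. (\<integral>z. indicator (S i) (fst z) *\<^sub>R \<Psi> z \<partial>L) - measure M (S i) *\<^sub>R (\<integral>z. \<Psi> z \<partial>L)) \<longlonglongrightarrow> 0"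
    by (rule ext[OF S])
  have [measurable]: "S i \<in> sets M" for i using S by (simp add: asymptotically_invariant_def)
  note [measurable] = borel_measurable_integrable[OF \<Psi>]
  have 1: "(\<integral>z. indicator (F (t i) ` S i) (fst z) *\<^sub>R \<Psi> z \<partial>L)
      = (\<integral>z. indicator (S i) (fst z) *\<^sub>R \<Psi> (F (t i) (fst z), G (t i) (snd z)) \<partial>L)" for i
  proof -
    have "(\<integral>z. indicator (F (t i) ` S i) (fst z) *\<^sub>R \<Psi> z \<partial>L)
        = (\<integral>z. indicator (F (t i) ` S i) (F (t i) (fst z)) *\<^sub>R \<Psi> (F (t i) (fst z), G (t i) (snd z)) \<partial>L)"
      by (subst integral_L_flow[symmetric, of _ "t i"]) auto
    also have "\<dots> = (\<integral>z. indicator (S i) (fst z) *\<^sub>R \<Psi> (F (t i) (fst z), G (t i) (snd z)) \<partial>L)"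
      by (intro Bochner_Integration.integral_cong)
         (auto simp: X.flow_image_eq_vimage split: split_indicator)
    finally show ?thesis .
  qed
  have 2: "measure M (F (t i) ` S i) = measure M (S i)" for i
    by (simp add: X.measure_flow_image)
  show "(\<lambda>i. (\<integral>z. indicator (S i) (fst z) *\<^sub>R \<Psi> (F (t i) (fst z), G (t i) (snd z)) \<partial>L)
        - measure M (S i) *\<^sub>R (\<integral>z. \<Psi> z \<partial>L)) \<longlonglongrightarrow> 0"
    using ext[OF X.asymptotically_invariant_flow_image[OF S, of t]] unfolding 1 2 .
qed

text \<open>
  The factors \<open>v i\<close> may vary with \<open>i\<close>, as will be needed for functions of \<open>G\<^sup>t y\<close>; only their uniform
  bound matters, since the two integrands differ on a set of vanishing measure.
\<close>

lemma integral_displacement_tendsto_0: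
  fixes \<psi> :: "'a \<times> 'b \<Rightarrow> 'c::{banach, second_countable_topology}"
  assumes disp: "(\<lambda>i. displacement M F (t i) (S i) (indicator A)) \<longlonglongrightarrow> 0"
    and S[measurable]: "\<And>i. S i \<in> sets M" and A[measurable]: "A \<in> sets M"
    and \<psi>: "integrable L \<psi>"
    and v[measurable]: "\<And>i. v i \<in> borel_measurable N" and v1: "\<And>i y. \<bar>v i y\<bar> \<le> (1::real)"
  shows "(\<lambda>i::nat. (\<integral>z. indicator (S i) (fst z) *\<^sub>R (indicator A (F (t i) (fst z)) *\<^sub>R v i (snd z) *\<^sub>R \<psi> z) \<partial>L)
    - (\<integral>z. indicator (S i) (fst z) *\<^sub>R (indicator A (fst z) *\<^sub>R v i (snd z) *\<^sub>R \<psi> z) \<partial>L)) \<longlonglongrightarrow> 0"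
proof -
  note [measurable] = borel_measurable_integrable[OF \<psi>]
  define E where "E i = {z \<in> space L. fst z \<in> S i \<and> (F (t i) (fst z) \<in> A \<longleftrightarrow> fst z \<notin> A)}" for i
  have [measurable]: "E i \<in> sets L" for i unfolding E_def by measurable
  have E: "measure L (E i) = displacement M F (t i) (S i) (indicator A)" for i
  proof -
    have "measure L (E i) = (\<integral>z. indicator (E i) z \<partial>L)" by simp
    also have "\<dots> = (\<integral>z. indicator (S i) (fst z) * \<bar>indicator A (F (t i) (fst z)) - indicator A (fst z)\<bar> \<partial>L)"
      by (intro Bochner_Integration.integral_cong) (auto simp: E_def split: split_indicator)
    also have "\<dots> = displacement M F (t i) (S i) (indicator A)"
      unfolding displacement_def by (subst integral_L_fst[symmetric]) auto
    finally show ?thesis .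
  qed
  have "(\<lambda>i. (\<integral>z. indicator (E i) z *\<^sub>R norm (\<psi> z) \<partial>L) - 0 *\<^sub>R (\<integral>z. norm (\<psi> z) \<partial>L)) \<longlonglongrightarrow> 0"
  proof (rule weak_limit_of_indicators)
    fix C assume [measurable]: "C \<in> sets L"
    have "norm (measure L (E i \<inter> C)) \<le> displacement M F (t i) (S i) (indicator A)" for i
      unfolding E[symmetric] by (auto intro: L.finite_measure_mono)
    then have "(\<lambda>i. measure L (E i \<inter> C)) \<longlonglongrightarrow> 0"
      by (intro Lim_null_comparison[OF always_eventually disp] allI)
    then show "(\<lambda>i. measure L (E i \<inter> C) - 0 * measure L C) \<longlonglongrightarrow> 0" by simp
  qed (auto intro: L.finite_measure_axioms \<psi>)
  then have lim: "(\<lambda>i. \<integral>z. indicator (E i) z *\<^sub>R norm (\<psi> z) \<partial>L) \<longlonglongrightarrow> 0" by simp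
  have int: "integrable L (\<lambda>z. indicator (S i) (fst z) *\<^sub>R (indicator A (f z) *\<^sub>R v i (snd z) *\<^sub>R \<psi> z))"
    if [measurable]: "f \<in> measurable L M" for f i
  proof (rule Bochner_Integration.integrable_bound[OF \<psi>])
    show "AE z in L. norm (indicator (S i) (fst z) *\<^sub>R (indicator A (f z) *\<^sub>R v i (snd z) *\<^sub>R \<psi> z)) \<le> norm (\<psi> z)"
      using v1 by (intro AE_I2) (auto split: split_indicator intro!: mult_left_le_one_le)
  qed measurable
  show ?thesis
  proof (rule Lim_null_comparison[OF always_eventually lim], intro allI)
    fix i
    have "(\<integral>z. indicator (S i) (fst z) *\<^sub>R (indicator A (F (t i) (fst z)) *\<^sub>R v i (snd z) *\<^sub>R \<psi> z) \<partial>L)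
        - (\<integral>z. indicator (S i) (fst z) *\<^sub>R (indicator A (fst z) *\<^sub>R v i (snd z) *\<^sub>R \<psi> z) \<partial>L)
      = (\<integral>z. indicator (S i) (fst z) *\<^sub>R (indicator A (F (t i) (fst z)) *\<^sub>R v i (snd z) *\<^sub>R \<psi> z)
          - indicator (S i) (fst z) *\<^sub>R (indicator A (fst z) *\<^sub>R v i (snd z) *\<^sub>R \<psi> z) \<partial>L)" (is "_ = (\<integral>z. ?d z \<partial>L)")
      by (subst Bochner_Integration.integral_diff[OF int int]) auto
    also have "norm \<dots> \<le> (\<integral>z. indicator (E i) z *\<^sub>R norm (\<psi> z) \<partial>L)"
    proof (rule order_trans[OF integral_norm_bound integral_mono])
      show "integrable L (\<lambda>z. norm (?d z))"
        by (intro integrable_norm Bochner_Integration.integrable_diff int) auto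
      show "integrable L (\<lambda>z. indicator (E i) z *\<^sub>R norm (\<psi> z))"
        by (intro integrable_mult_indicator integrable_norm \<psi>) auto
      show "norm (?d z) \<le> indicator (E i) z *\<^sub>R norm (\<psi> z)" if "z \<in> space L" for z
        using v1[of i "snd z"] that
        by (auto simp: E_def split: split_indicator intro!: mult_left_le_one_le)
    qed
    finally show "norm ((\<integral>z. indicator (S i) (fst z) *\<^sub>R (indicator A (F (t i) (fst z)) *\<^sub>R v i (snd z) *\<^sub>R \<psi> z) \<partial>L)
        - (\<integral>z. indicator (S i) (fst z) *\<^sub>R (indicator A (fst z) *\<^sub>R v i (snd z) *\<^sub>R \<psi> z) \<partial>L))
      \<le> (\<integral>z. indicator (E i) z *\<^sub>R norm (\<psi> z) \<partial>L)" .
  qed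
qed

end

locale rigid_joining = flow_joining M F N G L
  for M :: "'a::second_countable_topology measure" and F
    and N :: "'b::second_countable_topology measure" and G
    and L :: "('a \<times> 'b) measure" +
  fixes c :: real and t :: "nat \<Rightarrow> real" and S :: "nat \<Rightarrow> 'a set"
  assumes c: "c > 0" and S_inv: "asymptotically_invariant M F S"
    and S_large: "c \<le> measure M (S i)"
    and S_rigid: "A \<in> sets M \<Longrightarrow> (\<lambda>i. displacement M F (t i) (S i) (indicator A)) \<longlonglongrightarrow> 0"
begin

lemma S_sets [measurable]: "S i \<in> sets M"
  using S_inv by (simp add: asymptotically_invariant_def)

lemma eq_if_measure_S_scaled_diff_tendsto_0:
  assumes "(\<lambda>i. measure M (S i) * (a - b)) \<longlonglongrightarrow> (0 :: real)"
  shows "a = b"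
proof -
  have "(\<lambda>i. c * \<bar>a - b\<bar>) \<longlonglongrightarrow> 0"
    using S_large c by (intro Lim_null_comparison[OF always_eventually tendsto_norm_zero[OF assms]])
      (auto simp: abs_mult mult_right_mono)
  then show ?thesis using c by (simp add: LIMSEQ_const_iff)
qed

text \<open>
  Let \<open>I\<close> be the integral in question. The average of \<open>1\<^sub>A(F\<^sup>t x) e(G\<^sup>t y)\<close> over \<open>S\<^sub>i\<close> tends to \<open>I\<close> by
  equidistribution. It is also \<open>exp(t\<^sub>i \<alpha>)\<close> times the average of \<open>1\<^sub>A(F\<^sup>t x) e(y)\<close>, in which rigidity allows
  \<open>F\<^sup>t x\<close> to be replaced by \<open>x\<close>, so it is close to \<open>exp(t\<^sub>i \<alpha>) I\<close> as well. As \<open>exp(t\<^sub>i \<alpha>)\<close> stays away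
  from 1, \<open>I\<close> vanishes.
\<close>

lemma eigenfunction_uncorrelated:
  assumes e: "integrable N e" and eig: "\<And>s. AE y in N. e (G s y) = cis (s * \<alpha>) * e y"
    and \<alpha>: "0 < (INF i. cmod (cis (t i * \<alpha>) - 1))" and A[measurable]: "A \<in> sets M"
  shows "(\<integral>z. indicator A (fst z) *\<^sub>R e (snd z) \<partial>L) = 0"
proof -
  note [measurable] = borel_measurable_integrable[OF e]
  note eL = integrable_L_snd[OF e]
  define I where "I = (\<integral>z. indicator A (fst z) *\<^sub>R e (snd z) \<partial>L)"
  define \<iota> where "\<iota> = (INF i. cmod (cis (t i * \<alpha>) - 1))"
  define a where "a i = (\<integral>z. indicator (S i) (fst z) *\<^sub>R (indicator A (F (t i) (fst z)) *\<^sub>R e (snd z)) \<partial>L)" for i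
  define b where "b i = (\<integral>z. indicator (S i) (fst z) *\<^sub>R (indicator A (fst z) *\<^sub>R e (snd z)) \<partial>L)" for i
  have int: "integrable L (\<lambda>z. indicator A (fst z) *\<^sub>R e (snd z))"
    using eL by (rule Bochner_Integration.integrable_bound) (auto split: split_indicator)
  have 1: "(\<lambda>i. cis (t i * \<alpha>) * a i - measure M (S i) *\<^sub>R I) \<longlonglongrightarrow> 0"
  proof -
    have "(\<integral>z. indicator (S i) (fst z) *\<^sub>R (indicator A (F (t i) (fst z)) *\<^sub>R e (G (t i) (snd z))) \<partial>L)
        = cis (t i * \<alpha>) * a i" for i
    proof -
      have "(\<integral>z. indicator (S i) (fst z) *\<^sub>R (indicator A (F (t i) (fst z)) *\<^sub>R e (G (t i) (snd z))) \<partial>L)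
        = (\<integral>z. cis (t i * \<alpha>) * (indicator (S i) (fst z) *\<^sub>R (indicator A (F (t i) (fst z)) *\<^sub>R e (snd z))) \<partial>L)"
        using AE_L_snd[OF eig[of "t i"]] by (intro integral_cong_AE) (auto elim: eventually_mono)
      then show ?thesis unfolding a_def by (simp only: integral_mult_right_zero)
    qed
    then show ?thesis
      using averages_over_asymptotically_invariant(2)[OF S_inv int, of t] by (simp add: I_def)
  qed
  have 2: "(\<lambda>i. b i - measure M (S i) *\<^sub>R I) \<longlonglongrightarrow> 0"
    using averages_over_asymptotically_invariant(1)[OF S_inv int] by (simp add: I_def b_def)
  have 3: "(\<lambda>i. a i - b i) \<longlonglongrightarrow> 0"
    using integral_displacement_tendsto_0[OF S_rigid[OF A] S_sets A eL, of "\<lambda>_ _. 1"]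
    by (simp add: a_def b_def)
  have "(\<lambda>i. norm (cis (t i * \<alpha>) * a i - measure M (S i) *\<^sub>R I) + norm (a i - b i)
      + norm (b i - measure M (S i) *\<^sub>R I)) \<longlonglongrightarrow> 0"
    by (intro tendsto_add_zero tendsto_norm_zero 1 2 3)
  then have "(\<lambda>i. c * \<iota> * norm I) \<longlonglongrightarrow> 0"
  proof (rule Lim_null_comparison[OF always_eventually, rotated], intro allI)
    fix i
    have "\<iota> \<le> cmod (cis (t i * \<alpha>) - 1)"
      unfolding \<iota>_def by (intro cINF_lower bdd_belowI[of _ 0]) auto
    then have "c * \<iota> * norm I \<le> measure M (S i) * cmod (cis (t i * \<alpha>) - 1) * norm I"
      using S_large[of i] c \<alpha> by (intro mult_right_mono mult_mono) (auto simp: \<iota>_def)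
    also have "\<dots> = norm ((cis (t i * \<alpha>) - 1) * (measure M (S i) *\<^sub>R I))"
      by (simp add: norm_mult)
    also have "(cis (t i * \<alpha>) - 1) * (measure M (S i) *\<^sub>R I)
        = (cis (t i * \<alpha>) * a i - measure M (S i) *\<^sub>R I) - cis (t i * \<alpha>) * (a i - b i)
          - cis (t i * \<alpha>) * (b i - measure M (S i) *\<^sub>R I)"
      by (simp add: algebra_simps)
    also have "norm \<dots> \<le> norm (cis (t i * \<alpha>) * a i - measure M (S i) *\<^sub>R I) + norm (a i - b i)
        + norm (b i - measure M (S i) *\<^sub>R I)"
      using norm_triangle_ineq4[of "cis (t i * \<alpha>) * a i - measure M (S i) *\<^sub>R I - cis (t i * \<alpha>) * (a i - b i)"
          "cis (t i * \<alpha>) * (b i - measure M (S i) *\<^sub>R I)"]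
        norm_triangle_ineq4[of "cis (t i * \<alpha>) * a i - measure M (S i) *\<^sub>R I" "cis (t i * \<alpha>) * (a i - b i)"]
      by (simp only: norm_mult norm_cis mult_1_left)
    finally show "norm (c * \<iota> * norm I) \<le> norm (cis (t i * \<alpha>) * a i - measure M (S i) *\<^sub>R I) + norm (a i - b i)
        + norm (b i - measure M (S i) *\<^sub>R I)"
      using c \<alpha> by (simp add: \<iota>_def)
  qed
  then show ?thesis
    using c \<alpha> by (simp add: LIMSEQ_const_iff I_def \<iota>_def)
qed

end

section \<open>Domination of measures on a product\<close>

text \<open>
  A grid set is a finite union of rectangles over the cells of a finite measurable partition of the
  first space. The partition is coded by a labelling \<open>q\<close> of points with natural numbers, which makes
  complements immediate and unions a matter of pairing labels; finiteness of the label set lets an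
  inequality for rectangles be summed over the disjoint cells.
\<close>

definition grid_set :: "'a measure \<Rightarrow> 'b measure \<Rightarrow> ('a \<times> 'b) set \<Rightarrow> bool" where
  "grid_set M N R \<longleftrightarrow> (\<exists>(q :: 'a \<Rightarrow> nat) B. q \<in> measurable M (count_space UNIV) \<and>
    finite (q ` space M) \<and> (\<forall>n. B n \<in> sets N) \<and>
    R = {z \<in> space M \<times> space N. snd z \<in> B (q (fst z))})"

lemma grid_setI:
  "q \<in> measurable M (count_space UNIV) \<Longrightarrow> finite (q ` space M) \<Longrightarrow> (\<And>n::nat. B n \<in> sets N) \<Longrightarrow>
    R = {z \<in> space M \<times> space N. snd z \<in> B (q (fst z))} \<Longrightarrow> grid_set M N R"
  unfolding grid_set_def by blast

lemma grid_set_decomposition: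
  assumes q: "q \<in> measurable M (count_space UNIV)" and B: "\<And>n::nat. B n \<in> sets N"
  shows "{z \<in> space M \<times> space N. snd z \<in> B (q (fst z))}
    = (\<Union>n\<in>q ` space M. (q -` {n} \<inter> space M) \<times> B n)"
    and "disjoint_family_on (\<lambda>n. (q -` {n} \<inter> space M) \<times> B n) (q ` space M)"
    and "q -` {n} \<inter> space M \<in> sets M"
  using sets.sets_into_space[OF B] measurable_sets[OF q, of "{n}"]
  by (force simp: disjoint_family_on_def)+

lemma sets_grid_set: "grid_set M N R \<Longrightarrow> R \<in> sets (M \<Otimes>\<^sub>M N)"
proof -
  assume "grid_set M N R"
  then obtain q B where q: "q \<in> measurable M (count_space UNIV)" "finite (q ` space M)"
    and B: "\<And>n::nat. B n \<in> sets N" and R: "R = {z \<in> space M \<times> space N. snd z \<in> B (q (fst z))}"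
    unfolding grid_set_def by blast
  show ?thesis
    unfolding R grid_set_decomposition(1)[where B=B and N=N, OF q(1) B]
    by (intro sets.finite_UN q(2) pair_measureI B grid_set_decomposition(3)[where B=B and N=N, OF q(1) B])
qed

lemma grid_set_Times:
  assumes [measurable]: "A \<in> sets M" "B \<in> sets N"
  shows "grid_set M N (A \<times> B)"
proof (rule grid_setI[of "\<lambda>x. if x \<in> A then 1 else 0" _ "\<lambda>n. if n = 1 then B else {}"])
  show "A \<times> B = {z \<in> space M \<times> space N. snd z \<in> (if (if fst z \<in> A then 1 else 0) = (1::nat) then B else {})}"
    using assms[THEN sets.sets_into_space] by (auto split: if_splits)
  show "finite ((\<lambda>x. if x \<in> A then 1 else 0 :: nat) ` space M)"
    by (rule finite_subset[of _ "{0, 1}"]) auto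
qed auto

lemma grid_set_Diff: "grid_set M N R \<Longrightarrow> grid_set M N (space M \<times> space N - R)"
proof -
  assume "grid_set M N R"
  then obtain q B where q: "q \<in> measurable M (count_space UNIV)" "finite (q ` space M)"
    and B: "\<And>n::nat. B n \<in> sets N" and R: "R = {z \<in> space M \<times> space N. snd z \<in> B (q (fst z))}"
    unfolding grid_set_def by blast
  show ?thesis
    by (rule grid_setI[OF q, of "\<lambda>n. space N - B n"]) (use B in \<open>auto simp: R\<close>)
qed

lemma grid_set_Un:
  assumes "grid_set M N R1" "grid_set M N R2"
  shows "grid_set M N (R1 \<union> R2)"
proof -
  obtain q1 B1 where 1: "q1 \<in> measurable M (count_space UNIV)" "finite (q1 ` space M)"
    "\<And>n::nat. B1 n \<in> sets N" and R1: "R1 = {z \<in> space M \<times> space N. snd z \<in> B1 (q1 (fst z))}"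
    using assms(1) unfolding grid_set_def by blast
  obtain q2 B2 where 2: "q2 \<in> measurable M (count_space UNIV)" "finite (q2 ` space M)"
    "\<And>n::nat. B2 n \<in> sets N" and R2: "R2 = {z \<in> space M \<times> space N. snd z \<in> B2 (q2 (fst z))}"
    using assms(2) unfolding grid_set_def by blast
  note [measurable] = 1(1) 2(1)
  show ?thesis
  proof (rule grid_setI[of "\<lambda>x. prod_encode (q1 x, q2 x)" _
        "\<lambda>n. B1 (fst (prod_decode n)) \<union> B2 (snd (prod_decode n))"])
    show "(\<lambda>x. prod_encode (q1 x, q2 x)) \<in> measurable M (count_space UNIV)" by measurable
    show "finite ((\<lambda>x. prod_encode (q1 x, q2 x)) ` space M)"
      by (rule finite_subset[of _ "prod_encode ` (q1 ` space M \<times> q2 ` space M)"]) (use 1(2) 2(2) in auto)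
  qed (use 1(3) 2(3) in \<open>auto simp: R1 R2\<close>)
qed

lemma grid_set_finite_UN:
  "(\<And>j. j < n \<Longrightarrow> grid_set M N (R j)) \<Longrightarrow> grid_set M N (\<Union>j<n::nat. R j)"
proof (induction n)
  case 0
  show ?case using grid_set_Times[of "{}" M "{}" N] by simp
next
  case (Suc n)
  then show ?case by (auto simp: lessThan_Suc intro!: grid_set_Un)
qed

text \<open>
  The sets that can be approximated in both measures at once form a \<open>\<sigma>\<close>-algebra that contains the
  rectangles. Both measures must be approximated by the same grid set so that an inequality between
  them can be passed to the limit.
\<close>

lemma approximation_by_grid_sets:
  assumes "finite_measure P" and sP: "sets P = sets (M \<Otimes>\<^sub>M N)"
    and "finite_measure Q" and sQ: "sets Q = sets (M \<Otimes>\<^sub>M N)"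
    and C: "C \<in> sets (M \<Otimes>\<^sub>M N)" and "e > 0"
  obtains R where "grid_set M N R" "measure P (sym_diff R C) + measure Q (sym_diff R C) < e"
proof -
  interpret P: finite_measure P by fact
  interpret Q: finite_measure Q by fact
  define m where "m E = measure P E + measure Q E" for E
  have mono: "m E \<le> m E'" if "E \<subseteq> E'" "E' \<in> sets (M \<Otimes>\<^sub>M N)" for E E'
    unfolding m_def using that by (intro add_mono P.finite_measure_mono Q.finite_measure_mono) (auto simp: sP sQ)
  have Un: "m (E \<union> E') \<le> m E + m E'" if "E \<in> sets (M \<Otimes>\<^sub>M N)" "E' \<in> sets (M \<Otimes>\<^sub>M N)" for E E'
    unfolding m_def using measure_Un_le[of E P E'] measure_Un_le[of E Q E'] that by (auto simp: sP sQ)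
  have UN: "m (\<Union>j<n. E j) \<le> (\<Sum>j<n. m (E j))" if "\<And>j. E j \<in> sets (M \<Otimes>\<^sub>M N)" for n :: nat and E
  proof (induction n)
    case (Suc n)
    have "m (\<Union>j<Suc n. E j) \<le> m (\<Union>j<n. E j) + m (E n)"
      using Un[of "\<Union>j<n. E j" "E n"] that by (simp add: lessThan_Suc Un_commute)
    then show ?case using Suc by simp
  qed (simp add: m_def)
  have "C \<in> sigma_sets (space M \<times> space N) {A \<times> B |A B. A \<in> sets M \<and> B \<in> sets N}"
    using C by (simp add: sets_pair_measure)
  then have "\<forall>e>0. \<exists>R. grid_set M N R \<and> m (sym_diff R C) < e"
  proof induction
    case (Basic C)
    then show ?case by (auto intro!: exI[of _ C] grid_set_Times simp: m_def)
  next
    case Empty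
    show ?case using grid_set_Times[of "{}" M "{}" N] by (auto intro!: exI[of _ "{}"] simp: m_def)
  next
    case (Compl C)
    show ?case
    proof (intro allI impI)
      fix e :: real assume "e > 0"
      with Compl obtain R where R: "grid_set M N R" "m (sym_diff R C) < e" by blast
      have "C \<subseteq> space M \<times> space N" "R \<subseteq> space M \<times> space N"
        using sigma_sets_into_sp[OF _ Compl.hyps] sets.sets_into_space[OF sets_grid_set[OF R(1)]]
        by (force dest: sets.sets_into_space simp: space_pair_measure)+
      then have "sym_diff (space M \<times> space N - R) (space M \<times> space N - C) = sym_diff R C" by auto
      with R show "\<exists>R. grid_set M N R \<and> m (sym_diff R (space M \<times> space N - C)) < e"
        by (intro exI[of _ "space M \<times> space N - R"]) (simp add: grid_set_Diff)
    qed
  next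
    case (Union C)
    have C[measurable]: "C j \<in> sets (M \<Otimes>\<^sub>M N)" for j
      using Union.hyps by (simp add: sets_pair_measure)
    show ?case
    proof (intro allI impI)
      fix e :: real assume "e > 0"
      have "(\<lambda>n. m ((\<Union>j. C j) - (\<Union>j<n. C j))) \<longlonglongrightarrow> 0 + 0"
        unfolding m_def
      proof (intro tendsto_add)
        have dec: "decseq (\<lambda>n. (\<Union>j. C j) - (\<Union>j<n. C j))"
          by (auto simp: decseq_def)
        have empty: "(\<Inter>n. (\<Union>j. C j) - (\<Union>j<n. C j)) = {}" by auto
        show "(\<lambda>n. measure P ((\<Union>j. C j) - (\<Union>j<n. C j))) \<longlonglongrightarrow> 0"
          "(\<lambda>n. measure Q ((\<Union>j. C j) - (\<Union>j<n. C j))) \<longlonglongrightarrow> 0"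
          using P.finite_Lim_measure_decseq[OF _ dec] Q.finite_Lim_measure_decseq[OF _ dec]
          unfolding empty by (auto simp: sP sQ image_subset_iff)
      qed
      then have "\<forall>\<^sub>F n in sequentially. m ((\<Union>j. C j) - (\<Union>j<n. C j)) < e / 2"
        using \<open>e > 0\<close> by (intro order_tendstoD(2)) auto
      then obtain n where n: "m ((\<Union>j. C j) - (\<Union>j<n. C j)) < e / 2"
        using eventually_happens'[OF sequentially_bot] by blast
      \<comment> \<open>The summand 1 keeps the error positive when \<open>n = 0\<close>.\<close>
      have "\<exists>R. grid_set M N R \<and> m (sym_diff R (C j)) < e / (2 * (real n + 1))" for j
        using Union.IH[of j] \<open>e > 0\<close> by simp
      then obtain R where R: "\<And>j. grid_set M N (R j)" "\<And>j. m (sym_diff (R j) (C j)) < e / (2 * (real n + 1))"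
        by metis
      note [measurable] = sets_grid_set[OF R(1)]
      have "m (sym_diff (\<Union>j<n. R j) (\<Union>j. C j))
          \<le> m ((\<Union>j<n. sym_diff (R j) (C j)) \<union> ((\<Union>j. C j) - (\<Union>j<n. C j)))"
        by (intro mono) auto
      also have "\<dots> \<le> m (\<Union>j<n. sym_diff (R j) (C j)) + m ((\<Union>j. C j) - (\<Union>j<n. C j))"
        by (intro Un) auto
      also have "m (\<Union>j<n. sym_diff (R j) (C j)) \<le> (\<Sum>j<n. m (sym_diff (R j) (C j)))"
        by (intro UN) auto
      also have "\<dots> \<le> (\<Sum>j<n. e / (2 * (real n + 1)))"
        using R(2) by (intro sum_mono less_imp_le)
      also have "\<dots> \<le> e / 2"
        using \<open>e > 0\<close> by (simp add: field_simps)
      finally have "m (sym_diff (\<Union>j<n. R j) (\<Union>j. C j)) < e"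
        using n by simp
      then show "\<exists>R. grid_set M N R \<and> m (sym_diff R (\<Union>j. C j)) < e"
        using grid_set_finite_UN[of n M N R] R(1) by blast
    qed
  qed
  then show thesis using that \<open>e > 0\<close> unfolding m_def by blast
qed

lemma domination_from_rectangles:
  assumes "finite_measure P" and sP: "sets P = sets (M \<Otimes>\<^sub>M N)"
    and "finite_measure Q" and sQ: "sets Q = sets (M \<Otimes>\<^sub>M N)"
    and rect: "\<And>A B. A \<in> sets M \<Longrightarrow> B \<in> sets N \<Longrightarrow> c * measure P (A \<times> B) \<le> measure Q (A \<times> B)"
    and "c \<ge> 0" and C: "C \<in> sets (M \<Otimes>\<^sub>M N)"
  shows "c * measure P C \<le> measure Q C"
proof (rule field_le_epsilon)
  interpret P: finite_measure P by fact
  interpret Q: finite_measure Q by fact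
  fix e :: real assume "e > 0"
  then have "e / (c + 1) > 0" using \<open>c \<ge> 0\<close> by simp
  then obtain R where R: "grid_set M N R"
    and less: "measure P (sym_diff R C) + measure Q (sym_diff R C) < e / (c + 1)"
    by (rule approximation_by_grid_sets[OF assms(1-4) C])
  have [measurable]: "R \<in> sets P" "R \<in> sets Q" "C \<in> sets P" "C \<in> sets Q"
    using sets_grid_set[OF R] C by (auto simp: sP sQ)
  obtain q B where q: "q \<in> measurable M (count_space UNIV)" "finite (q ` space M)"
    and B: "\<And>n::nat. B n \<in> sets N" and Req: "R = {z \<in> space M \<times> space N. snd z \<in> B (q (fst z))}"
    using R unfolding grid_set_def by blast
  note dec = grid_set_decomposition[where B=B and N=N, OF q(1) B]
  have cells: "(q -` {n} \<inter> space M) \<times> B n \<in> sets (M \<Otimes>\<^sub>M N)" for n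
    by (intro pair_measureI dec(3) B)
  have "c * measure P R = (\<Sum>n\<in>q ` space M. c * measure P ((q -` {n} \<inter> space M) \<times> B n))"
    unfolding Req dec(1) using cells
    by (subst P.finite_measure_finite_Union[OF q(2) _ dec(2)]) (auto simp: sP sum_distrib_left)
  also have "\<dots> \<le> (\<Sum>n\<in>q ` space M. measure Q ((q -` {n} \<inter> space M) \<times> B n))"
    by (intro sum_mono rect dec(3) B)
  also have "\<dots> = measure Q R"
    unfolding Req dec(1) using cells
    by (subst Q.finite_measure_finite_Union[OF q(2) _ dec(2)]) (auto simp: sQ)
  finally have grid: "c * measure P R \<le> measure Q R" .
  have "measure P C \<le> measure P R + measure P (sym_diff R C)"
    using P.abs_measure_Int_diff_le[of R C "space P"] sets.sets_into_space[of C P] sets.sets_into_space[of R P]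
    by (simp add: Int_absorb2)
  then have "c * measure P C \<le> c * measure P R + c * measure P (sym_diff R C)"
    using \<open>c \<ge> 0\<close> by (simp add: mult_left_mono flip: distrib_left)
  also have "\<dots> \<le> measure Q R + c * measure P (sym_diff R C)" using grid by simp
  also have "measure Q R \<le> measure Q C + measure Q (sym_diff R C)"
    using Q.abs_measure_Int_diff_le[of R C "space Q"] sets.sets_into_space[of C Q] sets.sets_into_space[of R Q]
    by (simp add: Int_absorb2)
  finally have "c * measure P C \<le> measure Q C + (measure Q (sym_diff R C) + c * measure P (sym_diff R C))"
    by simp
  also have "measure Q (sym_diff R C) + c * measure P (sym_diff R C)
      \<le> (c + 1) * (measure P (sym_diff R C) + measure Q (sym_diff R C))"
    using \<open>c \<ge> 0\<close> by (simp add: algebra_simps)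
  also have "\<dots> \<le> (c + 1) * (e / (c + 1))"
    using less \<open>c \<ge> 0\<close> by (intro mult_left_mono) auto
  also have "\<dots> = e" using \<open>c \<ge> 0\<close> by simp
  finally show "c * measure P C \<le> measure Q C + e" by simp
qed

section \<open>Conditional probabilities given the second factor\<close>

context flow_joining
begin

lemma conditional_indicator:
  assumes [measurable]: "A \<in> sets M"
  obtains h where "h \<in> borel_measurable N" "\<And>y. 0 \<le> h y" "\<And>y. h y \<le> 1"
    "distr (density L (\<lambda>z. ennreal (indicator A (fst z)))) N snd = density N (\<lambda>y. ennreal (h y))"
  by (rule pushforward_density[OF L.prob_space_axioms Y.prob_space_axioms measurable_L_snd snd_marginal,
        of "\<lambda>z. indicator A (fst z)"]) (auto split: split_indicator)

context
  fixes A :: "'a set" and h :: "'b \<Rightarrow> real"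
  assumes A[measurable]: "A \<in> sets M"
    and h[measurable]: "h \<in> borel_measurable N" and h01: "\<And>y. 0 \<le> h y" "\<And>y. h y \<le> 1"
    and h_density: "distr (density L (\<lambda>z. ennreal (indicator A (fst z)))) N snd = density N (\<lambda>y. ennreal (h y))"
begin

lemma integral_conditional_indicator:
  fixes k :: "'b \<Rightarrow> 'c::{banach, second_countable_topology}"
  assumes [measurable]: "k \<in> borel_measurable N"
  shows "(\<integral>z. indicator A (fst z) *\<^sub>R k (snd z) \<partial>L) = (\<integral>y. h y *\<^sub>R k y \<partial>N)"
  by (rule integral_pushforward_density[OF h_density]) (auto simp: h01)

lemma expectation_conditional_indicator: "(\<integral>y. h y \<partial>N) = measure M A"
proof -
  have "(\<integral>y. h y \<partial>N) = (\<integral>z. indicator A (fst z) *\<^sub>R (1::real) \<partial>L)"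
    by (subst integral_conditional_indicator) auto
  also have "\<dots> = measure M A"
    using integral_L_fst[of "indicator A :: _ \<Rightarrow> real"] by simp
  finally show ?thesis .
qed

lemma centred_le_1: "\<bar>h y - measure M A\<bar> \<le> 1"
  using h01[of y] X.prob_le_1[of A] measure_nonneg[of M A]
  unfolding abs_le_iff by linarith

end

end

context rigid_joining
begin

context
  fixes A :: "'a set" and h :: "'b \<Rightarrow> real"
  assumes A[measurable]: "A \<in> sets M"
    and h[measurable]: "h \<in> borel_measurable N" and h01: "\<And>y. 0 \<le> h y" "\<And>y. h y \<le> 1"
    and h_density: "distr (density L (\<lambda>z. ennreal (indicator A (fst z)))) N snd = density N (\<lambda>y. ennreal (h y))"
    and star: "condition_star N (koopman G) t"
begin

lemmas conditional = integral_conditional_indicator[OF A h h01 h_density]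
lemmas conditional_mean = expectation_conditional_indicator[OF A h h01 h_density]
lemmas conditional_bound = centred_le_1[OF A h h01 h_density]

text \<open>
  A nonconstant eigenfunction is uncorrelated with every set \<open>A\<close> of the first factor, and in particular,
  for \<open>A\<close> the whole space, has mean zero; against constants the centring suffices.
\<close>

lemma centred_orthogonal_to_eigenfunctions:
  assumes e: "eigenfunction N (koopman G) \<alpha> e"
  shows "(\<integral>y. complex_of_real (h y - measure M A) * cnj (e y) \<partial>N) = 0"
proof -
  have sq: "e \<in> square_integrable N" and eig: "\<And>s. AE y in N. e (G s y) = cis (s * \<alpha>) * e y"
    using e by (auto simp: eigenfunction_def koopman_def)
  have int: "integrable N e" by (rule Y.square_integrable_imp_integrable[OF sq])
  note [measurable] = borel_measurable_integrable[OF int]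
  have hint: "integrable N (\<lambda>y. h y *\<^sub>R e y)"
    using int by (rule Bochner_Integration.integrable_bound) (auto simp: h01 mult_left_le_one_le)
  have "(\<integral>y. complex_of_real (h y - measure M A) * e y \<partial>N) = 0"
  proof (cases "\<exists>b. AE y in N. e y = b")
    case True
    then obtain b where b: "AE y in N. e y = b" by blast
    then have "(\<integral>y. complex_of_real (h y - measure M A) * e y \<partial>N)
        = (\<integral>y. complex_of_real (h y - measure M A) * b \<partial>N)"
      by (intro integral_cong_AE) (auto elim: eventually_mono)
    also have "\<dots> = complex_of_real (\<integral>y. h y - measure M A \<partial>N) * b"
      by (simp only: integral_mult_left_zero integral_complex_of_real)
    also have "(\<integral>y. h y - measure M A \<partial>N) = 0"
      using h01 by (subst Bochner_Integration.integral_diff)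
        (auto simp: conditional_mean Y.prob_space intro: Y.integrable_bounded[of _ 1])
    finally show ?thesis by simp
  next
    case False
    then have \<alpha>: "0 < (INF i. cmod (cis (t i * \<alpha>) - 1))"
      using star e by (auto simp: condition_star_def nonconstant_eigenvalue_def)
    have 1: "(\<integral>y. h y *\<^sub>R e y \<partial>N) = 0"
      using eigenfunction_uncorrelated[OF int eig \<alpha> A]
      by (simp add: conditional)
    have "(\<integral>z. indicator (space M) (fst z) *\<^sub>R e (snd z) \<partial>L) = 0"
      by (rule eigenfunction_uncorrelated[OF int eig \<alpha>]) simp
    then have 2: "(\<integral>y. e y \<partial>N) = 0"
      by (simp add: X.space_eq_UNIV integral_L_snd)
    have "(\<integral>y. complex_of_real (h y - measure M A) * e y \<partial>N)
        = (\<integral>y. h y *\<^sub>R e y - measure M A *\<^sub>R e y \<partial>N)"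
      by (intro Bochner_Integration.integral_cong) (auto simp: scaleR_conv_of_real algebra_simps)
    also have "\<dots> = 0"
      using int hint 1 2 by simp
    finally show ?thesis .
  qed
  moreover have "(\<integral>y. complex_of_real (h y - measure M A) * cnj (e y) \<partial>N)
      = cnj (\<integral>y. complex_of_real (h y - measure M A) * e y \<partial>N)"
    unfolding Bochner_Integration.integral_cnj[symmetric] by (intro Bochner_Integration.integral_cong) simp_all
  ultimately show ?thesis by (simp only: complex_cnj_zero)
qed

text \<open>
  Orthogonality to all eigenfunctions passes to their closed span because the inner product with a
  function bounded by 1 is at most the \<open>L\<^sup>2\<close> norm. No projection onto the span is involved: the
  functions to which the mixing part of condition (*) will be applied are conditional expectations of
  sets of the first factor, and these already lie in the continuous part up to a constant.
\<close>

lemma centred_in_H_c: "(\<lambda>y. complex_of_real (h y - measure M A)) \<in> H_c N (koopman G)"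
proof -
  let ?u = "\<lambda>y. complex_of_real (h y - measure M A)"
  have "norm ((cmod (?u y))\<^sup>2) \<le> 1" for y
    using power_le_one[OF abs_ge_zero conditional_bound[of y], of 2] by (simp flip: of_real_diff)
  then have u: "?u \<in> square_integrable N"
    unfolding square_integrable_def by (auto intro: Y.integrable_bounded[of _ 1])
  have orth: "l2_inner N ?u g = 0" if g: "g \<in> H_pp N (koopman G)" for g
  proof -
    have gsq: "g \<in> square_integrable N" using g by (simp add: H_pp_def)
    have small: "cmod (l2_inner N ?u g) \<le> \<epsilon>" if "\<epsilon> > 0" for \<epsilon>
    proof -
      have "\<exists>(n::nat) a e. (\<forall>k<n. \<exists>\<alpha>. eigenfunction N (koopman G) \<alpha> (e k)) \<and>
          l2_norm N (\<lambda>y. g y - (\<Sum>k<n. a k * e k y)) < \<epsilon>"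
        using g that by (simp add: H_pp_def)
      then obtain n :: nat and a e where e: "\<And>k. k < n \<Longrightarrow> \<exists>\<alpha>. eigenfunction N (koopman G) \<alpha> (e k)"
        and close: "l2_norm N (\<lambda>y. g y - (\<Sum>k<n. a k * e k y)) < \<epsilon>"
        by blast
      define d where "d y = g y - (\<Sum>k<n. a k * e k y)" for y
      have esq: "e k \<in> square_integrable N" if "k < n" for k
        using e[OF that] by (auto simp: eigenfunction_def)
      have eint: "integrable N (e k)" if "k < n" for k
        using esq[OF that] by (rule Y.square_integrable_imp_integrable)
      have gint: "integrable N g" using gsq by (rule Y.square_integrable_imp_integrable)
      have dint: "integrable N d"
        unfolding d_def using gint eint by (intro Bochner_Integration.integrable_diff Bochner_Integration.integrable_sum) auto
      note [measurable] = borel_measurable_integrable[OF dint]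
      have bd: "integrable N (\<lambda>y. ?u y * cnj (k y))" if "integrable N k" for k
      proof (rule Bochner_Integration.integrable_bound[OF that])
        show "AE y in N. norm (?u y * cnj (k y)) \<le> norm (k y)"
          using conditional_bound by (intro AE_I2) (auto simp: norm_mult simp flip: of_real_diff intro!: mult_left_le_one_le)
        have [measurable]: "(\<lambda>y. cnj (k y)) \<in> borel_measurable N"
          using that by (intro borel_measurable_integrable integrable_cnj)
        show "(\<lambda>y. ?u y * cnj (k y)) \<in> borel_measurable N" by measurable
      qed
      have "l2_inner N ?u g = (\<integral>y. ?u y * cnj (d y) + (\<Sum>k<n. cnj (a k) * (?u y * cnj (e k y))) \<partial>N)"
        unfolding l2_inner_def d_def
        by (intro Bochner_Integration.integral_cong) (auto simp: algebra_simps sum_distrib_left)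
      also have "\<dots> = (\<integral>y. ?u y * cnj (d y) \<partial>N) + (\<Sum>k<n. cnj (a k) * (\<integral>y. ?u y * cnj (e k y) \<partial>N))"
        using bd[OF dint] bd[OF eint]
        by (subst Bochner_Integration.integral_add) (auto intro!: Bochner_Integration.integrable_sum simp: Bochner_Integration.integral_sum)
      also have "(\<Sum>k<n. cnj (a k) * (\<integral>y. ?u y * cnj (e k y) \<partial>N)) = 0"
        using centred_orthogonal_to_eigenfunctions e by (intro sum.neutral) fastforce
      finally have "cmod (l2_inner N ?u g) \<le> (\<integral>y. cmod (?u y * cnj (d y)) \<partial>N)"
        using integral_norm_bound[of N "\<lambda>y. ?u y * cnj (d y)"] by simp
      also have "\<dots> \<le> (\<integral>y. cmod (d y) \<partial>N)"
        using bd[OF dint] dint conditional_bound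
        by (intro integral_mono integrable_norm) (auto simp: norm_mult simp flip: of_real_diff intro!: mult_left_le_one_le)
      also have "\<dots> \<le> l2_norm N d"
      proof -
        have dsq: "integrable N (\<lambda>y. (cmod (d y))\<^sup>2)"
        proof -
          have "(\<lambda>y. g y + (\<Sum>k<n. - a k * e k y)) \<in> square_integrable N"
            by (intro square_integrable_add gsq square_integrable_sum square_integrable_cmult esq)
          then show ?thesis by (simp add: d_def square_integrable_def sum_negf)
        qed
        \<comment> \<open>The variance of \<open>cmod (d y)\<close> is nonnegative.\<close>
        have "(\<integral>y. cmod (d y) \<partial>N)\<^sup>2 \<le> (\<integral>y. (cmod (d y))\<^sup>2 \<partial>N)"
          using Y.variance_eq[OF integrable_norm[OF dint] dsq] Y.variance_positive[of "\<lambda>y. cmod (d y)"] by simp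
        then show ?thesis unfolding l2_norm_def by (rule real_le_rsqrt)
      qed
      also have "\<dots> \<le> \<epsilon>" using close by (simp add: d_def[abs_def])
      finally show ?thesis .
    qed
    have "cmod (l2_inner N ?u g) \<le> 0"
      by (rule field_le_epsilon) (unfold add_0, rule small)
    then show ?thesis by simp
  qed
  show ?thesis
    unfolding H_c_def using u orth by blast
qed

lemma conditional_indicator_mixes:
  fixes g :: "'b \<Rightarrow> real"
  assumes [measurable]: "g \<in> borel_measurable N" and g: "\<And>y. \<bar>g y\<bar> \<le> K"
  shows "(\<lambda>i. \<integral>y. (h (G (t i) y) - measure M A) * g y \<partial>N) \<longlonglongrightarrow> 0"
proof -
  have "norm ((cmod (complex_of_real (g y)))\<^sup>2) \<le> K\<^sup>2" for y
    using power_mono[OF g abs_ge_zero, of y 2] by simp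
  then have "(\<lambda>y. complex_of_real (g y)) \<in> square_integrable N"
    unfolding square_integrable_def by (auto intro: Y.integrable_bounded[of _ "K\<^sup>2"])
  then have lim: "(\<lambda>i. l2_inner N (koopman G (t i) (\<lambda>y. complex_of_real (h y - measure M A)))
      (\<lambda>y. complex_of_real (g y))) \<longlonglongrightarrow> 0"
    using star centred_in_H_c by (auto simp: condition_star_def)
  have "l2_inner N (koopman G (t i) (\<lambda>y. complex_of_real (h y - measure M A))) (\<lambda>y. complex_of_real (g y))
      = complex_of_real (\<integral>y. (h (G (t i) y) - measure M A) * g y \<partial>N)" for i
    unfolding l2_inner_def koopman_def integral_complex_of_real[symmetric]
    by (intro Bochner_Integration.integral_cong) simp_all
  with lim have "(\<lambda>i. complex_of_real (\<integral>y. (h (G (t i) y) - measure M A) * g y \<partial>N)) \<longlonglongrightarrow> complex_of_real 0"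
    by (simp only: of_real_0)
  then show ?thesis by (simp only: tendsto_of_real_iff)
qed

text \<open>
  By mixing, \<open>L(F\<^sup>-\<^sup>tA \<times> B)\<close> tends to \<open>\<mu>(A) \<nu>(B)\<close> along \<open>t\<^sub>i\<close>. By rigidity, the points of \<open>S\<^sub>i\<close> alone contribute
  about \<open>\<mu>(S\<^sub>i) L(A \<times> B)\<close> to it.
\<close>

lemma rectangle_domination:
  assumes B[measurable]: "B \<in> sets N"
  shows "c * measure L (A \<times> B) \<le> measure M A * measure N B"
proof -
  \<comment> \<open>By invariance this is \<open>L(F\<^sup>-\<^sup>tA \<times> B)\<close>, here expressed on the second factor where mixing applies.\<close>
  define r where "r i = (\<integral>y. h (G (t i) y) * indicator B y \<partial>N)" for i
  have AB: "A \<times> B \<in> sets L" by (simp add: sets_L)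
  have r_lim: "r \<longlonglongrightarrow> measure M A * measure N B"
  proof -
    have hB: "integrable N (\<lambda>y. h (G s y) * indicator B y)" for s
      using h01 by (intro Y.integrable_bounded[of _ 1]) (auto split: split_indicator)
    have "(\<integral>y. (h (G (t i) y) - measure M A) * indicator B y \<partial>N) = r i - measure M A * measure N B" for i
      unfolding r_def left_diff_distrib
      by (subst Bochner_Integration.integral_diff[OF hB]) (auto simp: Y.emeasure_eq_measure)
    then show ?thesis
      using conditional_indicator_mixes[of "indicator B" 1] by (simp add: LIM_zero_iff split: split_indicator)
  qed
  have r: "r i = (\<integral>z. indicator A (F (t i) (fst z)) * indicator B (snd z) \<partial>L)" for i
  proof -
    have "r i = (\<integral>y. h (G (t i) y) * indicator B (G (- t i) (G (t i) y)) \<partial>N)"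
      by (simp add: r_def)
    also have "\<dots> = (\<integral>y. h y * indicator B (G (- t i) y) \<partial>N)"
      by (subst Y.integral_flow[of "\<lambda>y. h y * indicator B (G (- t i) y)" "t i"]) auto
    also have "\<dots> = (\<integral>z. indicator A (fst z) * indicator B (G (- t i) (snd z)) \<partial>L)"
      using conditional[of "\<lambda>y. indicator B (G (- t i) y) :: real"] by simp
    also have "\<dots> = (\<integral>z. indicator A (F (t i) (fst z)) * indicator B (G (- t i) (G (t i) (snd z))) \<partial>L)"
      using integral_L_flow[of "\<lambda>z. indicator A (fst z) * indicator B (G (- t i) (snd z)) :: real" "t i"] by simp
    finally show ?thesis by simp
  qed
  have "(\<lambda>i. (\<integral>z. indicator (S i) (fst z) *\<^sub>R indicator (A \<times> B) z \<partial>L) - measure M (S i) *\<^sub>R (\<integral>z. indicator (A \<times> B) z \<partial>L) :: real) \<longlonglongrightarrow> 0"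
    using AB by (intro averages_over_asymptotically_invariant(1)[OF S_inv] L.integrable_bounded[of _ 1])
      (auto split: split_indicator)
  then have 1: "(\<lambda>i. (\<integral>z. indicator (S i) (fst z) * indicator (A \<times> B) z \<partial>L) - measure M (S i) * measure L (A \<times> B)) \<longlonglongrightarrow> 0"
    using AB by simp
  have 2: "(\<lambda>i. (\<integral>z. indicator (S i) (fst z) *\<^sub>R (indicator A (F (t i) (fst z)) *\<^sub>R indicator B (snd z) *\<^sub>R 1) \<partial>L)
    - (\<integral>z. indicator (S i) (fst z) *\<^sub>R (indicator A (fst z) *\<^sub>R indicator B (snd z) *\<^sub>R (1::real)) \<partial>L)) \<longlonglongrightarrow> 0"
    by (rule integral_displacement_tendsto_0[OF S_rigid[OF A] S_sets A]) (auto split: split_indicator)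
  have AB_eq: "indicator (A \<times> B) z = (indicator A (fst z) * indicator B (snd z) :: real)" for z
    by (cases z) (auto split: split_indicator)
  have le: "c * measure L (A \<times> B)
    + ((\<integral>z. indicator (S i) (fst z) * indicator (A \<times> B) z \<partial>L) - measure M (S i) * measure L (A \<times> B))
    + ((\<integral>z. indicator (S i) (fst z) *\<^sub>R (indicator A (F (t i) (fst z)) *\<^sub>R indicator B (snd z) *\<^sub>R 1) \<partial>L)
      - (\<integral>z. indicator (S i) (fst z) *\<^sub>R (indicator A (fst z) *\<^sub>R indicator B (snd z) *\<^sub>R (1::real)) \<partial>L)) \<le> r i" for i
  proof -
    have "(\<integral>z. indicator (S i) (fst z) *\<^sub>R (indicator A (F (t i) (fst z)) *\<^sub>R indicator B (snd z) *\<^sub>R 1) \<partial>L) \<le> r i"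
      unfolding r by (intro integral_mono L.integrable_bounded[of _ 1]) (auto split: split_indicator)
    moreover have "c * measure L (A \<times> B) \<le> measure M (S i) * measure L (A \<times> B)"
      using S_large[of i] by (intro mult_right_mono) auto
    ultimately show ?thesis by (simp add: AB_eq)
  qed
  have "(\<lambda>i. c * measure L (A \<times> B)
    + ((\<integral>z. indicator (S i) (fst z) * indicator (A \<times> B) z \<partial>L) - measure M (S i) * measure L (A \<times> B))
    + ((\<integral>z. indicator (S i) (fst z) *\<^sub>R (indicator A (F (t i) (fst z)) *\<^sub>R indicator B (snd z) *\<^sub>R 1) \<partial>L)
      - (\<integral>z. indicator (S i) (fst z) *\<^sub>R (indicator A (fst z) *\<^sub>R indicator B (snd z) *\<^sub>R (1::real)) \<partial>L)))
    \<longlonglongrightarrow> c * measure L (A \<times> B) + 0 + 0"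
    by (intro tendsto_add tendsto_const 1 2)
  then show ?thesis
    using LIMSEQ_le[OF _ r_lim] le by fastforce
qed

end

end

section \<open>Disjointness\<close>

text \<open>
  For fixed \<open>x\<close> the integral over \<open>y\<close> tends to 0 by weak convergence, so by dominated convergence its
  \<open>L\<^sup>1\<close> norm in \<open>x\<close> does. This norm does not see the sets \<open>E i\<close>, which may therefore vary arbitrarily.
\<close>

lemma weak_convergence_against_kernel:
  fixes D :: "'a \<times> 'b \<Rightarrow> real" and w :: "nat \<Rightarrow> 'b \<Rightarrow> real"
  assumes "prob_space M" "prob_space N"
    and D[measurable]: "D \<in> borel_measurable (M \<Otimes>\<^sub>M N)" and D_bound: "\<And>z. \<bar>D z\<bar> \<le> K"
    and E[measurable]: "\<And>i. E i \<in> sets M"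
    and w[measurable]: "\<And>i. w i \<in> borel_measurable N" and w1: "\<And>i y. \<bar>w i y\<bar> \<le> 1"
    and weak: "\<And>g. g \<in> borel_measurable N \<Longrightarrow> (\<And>y. \<bar>g y\<bar> \<le> K) \<Longrightarrow> (\<lambda>i. \<integral>y. w i y * g y \<partial>N) \<longlonglongrightarrow> 0"
  shows "(\<lambda>i. \<integral>z. D z * (indicator (E i) (fst z) * w i (snd z)) \<partial>(M \<Otimes>\<^sub>M N)) \<longlonglongrightarrow> 0"
proof -
  interpret M: prob_space M by fact
  interpret N: prob_space N by fact
  interpret P: pair_prob_space M N by unfold_locales
  define k where "k i x = (\<integral>y. w i y * D (x, y) \<partial>N)" for i x
  have [measurable]: "k i \<in> borel_measurable M" for i
    unfolding k_def by measurable
  have K0: "0 \<le> K" using order_trans[OF abs_ge_zero D_bound] .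
  have wD: "\<bar>w i y * D z\<bar> \<le> K" for i y z
    using mult_mono[OF w1[of i y] D_bound[of z]] by (simp add: abs_mult)
  have k_bound: "\<bar>k i x\<bar> \<le> K" if "x \<in> space M" for i x
  proof -
    have "\<bar>k i x\<bar> \<le> (\<integral>y. \<bar>w i y * D (x, y)\<bar> \<partial>N)"
      unfolding k_def using integral_norm_bound[of N "\<lambda>y. w i y * D (x, y)"] by simp
    also have "\<dots> \<le> (\<integral>y. K \<partial>N)"
      using that wD K0
      by (intro integral_mono N.integrable_const_bound[of _ K]) auto
    finally show ?thesis by (simp add: N.prob_space)
  qed
  have "(\<lambda>i. \<integral>x. \<bar>k i x\<bar> \<partial>M) \<longlonglongrightarrow> (\<integral>x. 0 \<partial>M)"
  proof (rule integral_dominated_convergence[where w="\<lambda>_. K"])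
    show "AE x in M. (\<lambda>i. \<bar>k i x\<bar>) \<longlonglongrightarrow> 0"
    proof (rule AE_I2)
      fix x assume "x \<in> space M"
      then show "(\<lambda>i. \<bar>k i x\<bar>) \<longlonglongrightarrow> 0"
        unfolding k_def by (intro tendsto_rabs_zero weak D_bound) auto
    qed
    show "AE x in M. norm \<bar>k i x\<bar> \<le> K" for i
      using k_bound by (intro AE_I2) auto
  qed auto
  then have lim: "(\<lambda>i. \<integral>x. \<bar>k i x\<bar> \<partial>M) \<longlonglongrightarrow> 0" by simp
  show ?thesis
  proof (rule Lim_null_comparison[OF always_eventually lim], intro allI)
    fix i
    have bd: "\<bar>D z * (indicator (E i) (fst z) * w i (snd z))\<bar> \<le> K" for z
      using wD[of i "snd z" z] D_bound[of z] by (auto simp: mult.commute split: split_indicator)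
    have "(\<integral>z. D z * (indicator (E i) (fst z) * w i (snd z)) \<partial>(M \<Otimes>\<^sub>M N))
        = (\<integral>x. \<integral>y. D (x, y) * (indicator (E i) x * w i y) \<partial>N \<partial>M)"
      using bd by (subst P.integral_fst'[symmetric]) (auto intro!: P.integrable_const_bound[of _ K])
    also have "\<dots> = (\<integral>x. indicator (E i) x * k i x \<partial>M)"
      unfolding k_def by (intro Bochner_Integration.integral_cong) (auto simp: mult.commute split: split_indicator)
    also have "norm \<dots> \<le> (\<integral>x. \<bar>k i x\<bar> \<partial>M)"
    proof (rule order_trans[OF integral_norm_bound integral_mono])
      show "integrable M (\<lambda>x. norm (indicator (E i) x * k i x))" "integrable M (\<lambda>x. \<bar>k i x\<bar>)"
        using k_bound K0 by (auto intro!: M.integrable_const_bound[of _ K] AE_I2 split: split_indicator)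
    qed (auto split: split_indicator)
    finally show "norm (\<integral>z. D z * (indicator (E i) (fst z) * w i (snd z)) \<partial>(M \<Otimes>\<^sub>M N)) \<le> (\<integral>x. \<bar>k i x\<bar> \<partial>M)" .
  qed
qed

lemma (in rigid_joining) bounded_density_of_joining:
  assumes star: "condition_star N (koopman G) t"
  obtains D where "D \<in> borel_measurable (M \<Otimes>\<^sub>M N)" "\<And>z. 0 \<le> D z" "\<And>z. D z \<le> 1 / c"
    "L = density (M \<Otimes>\<^sub>M N) (\<lambda>z. ennreal (D z))"
proof -
  interpret P: pair_prob_space M N by unfold_locales
  have rect: "c * measure L (A \<times> B) \<le> measure (M \<Otimes>\<^sub>M N) (A \<times> B)"
    if A: "A \<in> sets M" and B: "B \<in> sets N" for A B
  proof -
    obtain h where "h \<in> borel_measurable N" "\<And>y. 0 \<le> h y" "\<And>y. h y \<le> 1"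
      "distr (density L (\<lambda>z. ennreal (indicator A (fst z)))) N snd = density N (\<lambda>y. ennreal (h y))"
      using conditional_indicator[OF A] by blast
    from rectangle_domination[OF A this star B] show ?thesis
      using A B by (simp add: measure_def Y.emeasure_pair_measure_Times enn2real_mult)
  qed
  have dom: "c * measure L C \<le> measure (M \<Otimes>\<^sub>M N) C" if "C \<in> sets (M \<Otimes>\<^sub>M N)" for C
    by (rule domination_from_rectangles[OF L.finite_measure_axioms sets_L P.finite_measure_axioms refl
          rect less_imp_le[OF c] that])
  show thesis
  proof (rule bounded_density[of "M \<Otimes>\<^sub>M N" L "1 / c"])
    show "emeasure L C \<le> ennreal (1 / c) * emeasure (M \<Otimes>\<^sub>M N) C" if "C \<in> sets (M \<Otimes>\<^sub>M N)" for C
    proof -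
      have "measure L C \<le> 1 / c * measure (M \<Otimes>\<^sub>M N) C"
        using dom[OF that] c by (simp add: field_simps)
      then have "ennreal (measure L C) \<le> ennreal (1 / c * measure (M \<Otimes>\<^sub>M N) C)"
        by (rule ennreal_leI)
      also have "\<dots> = ennreal (1 / c) * ennreal (measure (M \<Otimes>\<^sub>M N) C)"
        using c by (intro ennreal_mult) auto
      finally show ?thesis
        by (simp only: L.emeasure_eq_measure P.emeasure_eq_measure)
    qed
  qed (use that c in \<open>auto simp: sets_L P.finite_measure_axioms\<close>)
qed

text \<open>
  Let \<open>h(y)\<close> be the conditional probability of \<open>x \<in> A\<close> given \<open>y\<close>. The average of \<open>1\<^sub>A(F\<^sup>t x) h(G\<^sup>t y)\<close> over \<open>S\<^sub>i\<close>
  with respect to \<open>L\<close> tends to \<open>\<integral> h\<^sup>2\<close> by equidistribution. By rigidity it is close to the average of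
  \<open>1\<^sub>A(x) h(G\<^sup>t y)\<close>, and there \<open>h(G\<^sup>t y)\<close> may be replaced by \<open>\<mu>(A)\<close>, because \<open>h \<circ> G\<^sup>t\<close> tends to \<open>\<mu>(A)\<close> weakly
  and \<open>L\<close> has a bounded density. Hence \<open>\<integral> h\<^sup>2 = \<mu>(A)\<^sup>2\<close>: the variance of \<open>h\<close> vanishes, and \<open>A\<close> is independent of
  the second factor.
\<close>

lemma (in rigid_joining) joining_eq_product:
  assumes star: "condition_star N (koopman G) t"
  shows "L = M \<Otimes>\<^sub>M N"
proof -
  obtain D where D[measurable]: "D \<in> borel_measurable (M \<Otimes>\<^sub>M N)"
    and D0: "\<And>z. 0 \<le> D z" and D_bound: "\<And>z. D z \<le> 1 / c"
    and L_eq: "L = density (M \<Otimes>\<^sub>M N) (\<lambda>z. ennreal (D z))"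
    by (rule bounded_density_of_joining[OF star]) blast
  have "measure L (A \<times> B) = measure M A * measure N B" if A[measurable]: "A \<in> sets M" and B[measurable]: "B \<in> sets N" for A B
  proof -
    obtain h where h[measurable]: "h \<in> borel_measurable N" and h01: "\<And>y. 0 \<le> h y" "\<And>y. h y \<le> 1"
      and hd: "distr (density L (\<lambda>z. ennreal (indicator A (fst z)))) N snd = density N (\<lambda>y. ennreal (h y))"
      using conditional_indicator[OF A] by blast
    note ctx = A h h01 hd
    define J where "J = (\<integral>y. h y * h y \<partial>N)"
    define w where "w i y = h (G (t i) y) - measure M A" for i y
    have [measurable]: "w i \<in> borel_measurable N" for i unfolding w_def by measurable
    have w1: "\<bar>w i y\<bar> \<le> 1" for i y unfolding w_def by (rule centred_le_1[OF ctx])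
    have intL: "integrable L f" if "f \<in> borel_measurable L" "\<And>z. \<bar>f z\<bar> \<le> 1" for f :: "_ \<Rightarrow> real"
      using that by (intro L.integrable_bounded[of _ 1]) auto
    have hJ: "(\<integral>z. indicator A (fst z) * h (snd z) \<partial>L) = J"
      using integral_conditional_indicator[OF ctx, of h] by (simp add: J_def)
    let ?a = "\<lambda>i. \<integral>z. indicator (S i) (fst z) * (indicator A (F (t i) (fst z)) * h (G (t i) (snd z))) \<partial>L"
    let ?b = "\<lambda>i. \<integral>z. indicator (S i) (fst z) * (indicator A (fst z) * h (G (t i) (snd z))) \<partial>L"
    let ?d = "\<lambda>i. \<integral>z. indicator (S i) (fst z) * indicator A (fst z) \<partial>L"
    have 1: "(\<lambda>i. ?a i - measure M (S i) * J) \<longlonglongrightarrow> 0"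
    proof -
      have "integrable L (\<lambda>z. indicator A (fst z) * h (snd z))"
        using h01 by (intro intL) (auto split: split_indicator)
      from averages_over_asymptotically_invariant(2)[OF S_inv this, of t]
      show ?thesis by (simp add: hJ)
    qed
    have 2: "(\<lambda>i. ?a i - ?b i) \<longlonglongrightarrow> 0"
      using integral_displacement_tendsto_0[OF S_rigid[OF A] S_sets A, of "\<lambda>_. 1::real" "\<lambda>i y. h (G (t i) y)"] h01
      by simp
    have 3: "(\<lambda>i. ?b i - measure M A * ?d i) \<longlonglongrightarrow> 0"
    proof -
      have "(\<lambda>i. \<integral>z. D z * (indicator (S i \<inter> A) (fst z) * w i (snd z)) \<partial>(M \<Otimes>\<^sub>M N)) \<longlonglongrightarrow> 0"
      proof (rule weak_convergence_against_kernel[of M N D "1 / c"])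
        show "\<bar>D z\<bar> \<le> 1 / c" for z using D0[of z] D_bound[of z] by simp
        show "(\<lambda>i. \<integral>y. w i y * g y \<partial>N) \<longlonglongrightarrow> 0"
          if "g \<in> borel_measurable N" "\<And>y. \<bar>g y\<bar> \<le> 1 / c" for g
          using conditional_indicator_mixes[OF ctx star that] by (simp add: w_def)
      qed (use w1 X.prob_space_axioms Y.prob_space_axioms in auto)
      moreover have "(\<integral>z. D z * (indicator (S i \<inter> A) (fst z) * w i (snd z)) \<partial>(M \<Otimes>\<^sub>M N))
          = ?b i - measure M A * ?d i" for i
      proof -
        have "(\<integral>z. D z * (indicator (S i \<inter> A) (fst z) * w i (snd z)) \<partial>(M \<Otimes>\<^sub>M N))
            = (\<integral>z. indicator (S i \<inter> A) (fst z) * w i (snd z) \<partial>L)"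
          unfolding L_eq using D0 by (subst integral_density) auto
        also have "\<dots> = (\<integral>z. indicator (S i) (fst z) * (indicator A (fst z) * h (G (t i) (snd z)))
            - measure M A * (indicator (S i) (fst z) * indicator A (fst z)) \<partial>L)"
          by (intro Bochner_Integration.integral_cong) (auto simp: w_def split: split_indicator)
        also have "\<dots> = ?b i - measure M A * ?d i"
          using h01 by (subst Bochner_Integration.integral_diff)
            (auto intro!: intL split: split_indicator simp: abs_mult mult_le_one)
        finally show ?thesis .
      qed
      ultimately show ?thesis by simp
    qed
    have 4: "(\<lambda>i. measure M A * ?d i - measure M A * (measure M (S i) * measure M A)) \<longlonglongrightarrow> 0"
    proof -
      have "integrable L (\<lambda>z. indicator A (fst z) :: real)"
        by (intro intL) (auto split: split_indicator)
      from averages_over_asymptotically_invariant(1)[OF S_inv this]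
      have "(\<lambda>i. ?d i - measure M (S i) * measure M A) \<longlonglongrightarrow> 0"
        using integral_L_fst[of "indicator A :: _ \<Rightarrow> real"] by simp
      from tendsto_mult_right_zero[OF this, of "measure M A"] show ?thesis
        by (simp add: right_diff_distrib)
    qed
    have "(\<lambda>i. (?a i - ?b i) - (?a i - measure M (S i) * J) + (?b i - measure M A * ?d i)
        + (measure M A * ?d i - measure M A * (measure M (S i) * measure M A))) \<longlonglongrightarrow> 0 - 0 + 0 + 0"
      by (intro tendsto_add tendsto_diff 1 2 3 4)
    then have "(\<lambda>i. measure M (S i) * (J - measure M A * measure M A)) \<longlonglongrightarrow> 0"
      by (simp add: algebra_simps)
    then have J: "J = measure M A * measure M A"
      by (rule eq_if_measure_S_scaled_diff_tendsto_0)
    have h_int: "integrable N h" and hh_int: "integrable N (\<lambda>y. h y * h y)"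
      using h01 by (auto intro!: Y.integrable_const_bound[of _ 1] AE_I2 mult_le_one)
    have "(\<integral>y. (h y - measure M A)\<^sup>2 \<partial>N) = (\<integral>y. h y * h y - 2 * measure M A * h y + measure M A * measure M A \<partial>N)"
      by (intro Bochner_Integration.integral_cong) (auto simp: power2_eq_square algebra_simps)
    also have "\<dots> = J - 2 * measure M A * (\<integral>y. h y \<partial>N) + measure M A * measure M A"
      using h_int hh_int by (simp add: J_def Y.prob_space)
    also have "\<dots> = 0"
      by (simp add: J expectation_conditional_indicator[OF ctx])
    finally have "AE y in N. (h y - measure M A)\<^sup>2 = 0"
      by (subst (asm) integral_nonneg_eq_0_iff_AE)
         (auto intro!: Y.integrable_const_bound[of _ 1] simp: abs_square_le_1 centred_le_1[OF ctx])
    then have h_const: "AE y in N. h y = measure M A" by simp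
    have "measure L (A \<times> B) = (\<integral>z. indicator (A \<times> B) z \<partial>L)"
      by (simp add: sets_L)
    also have "\<dots> = (\<integral>z. indicator A (fst z) *\<^sub>R indicator B (snd z) \<partial>L)"
      by (intro Bochner_Integration.integral_cong) (auto split: split_indicator)
    also have "\<dots> = (\<integral>y. h y *\<^sub>R indicator B y \<partial>N)"
      by (rule integral_conditional_indicator[OF ctx]) auto
    also have "\<dots> = (\<integral>y. measure M A * indicator B y \<partial>N)"
      using h_const by (intro integral_cong_AE) (auto elim: eventually_mono)
    also have "\<dots> = measure M A * measure N B" by simp
    finally show ?thesis .
  qed
  then have "M \<Otimes>\<^sub>M N = L"
    by (intro pair_measure_eqI X.sigma_finite_measure_axioms Y.sigma_finite_measure_axioms)
       (auto simp: sets_L L.emeasure_eq_measure X.emeasure_eq_measure Y.emeasure_eq_measure ennreal_mult)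
  then show ?thesis by simp
qed

lemma product_is_joining:
  assumes "pmp_flow M F" "pmp_flow N G"
  shows "joining M F N G (M \<Otimes>\<^sub>M N)"
proof -
  interpret X: pmp_flow M F by fact
  interpret Y: pmp_flow N G by fact
  interpret P: pair_prob_space M N by unfold_locales
  show ?thesis
    unfolding joining_def
  proof (intro conjI allI)
    show "prob_space (M \<Otimes>\<^sub>M N)" by (rule P.prob_space_axioms)
    show "distr (M \<Otimes>\<^sub>M N) M fst = M"
      by (rule Y.distr_pair_fst)
    show "distr (M \<Otimes>\<^sub>M N) N snd = N"
    proof (rule measure_eqI)
      fix B assume "B \<in> sets (distr (M \<Otimes>\<^sub>M N) N snd)"
      then have B: "B \<in> sets N" by simp
      then have "snd -` B \<inter> space (M \<Otimes>\<^sub>M N) = space M \<times> B"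
        using sets.sets_into_space by (force simp: space_pair_measure)
      then show "emeasure (distr (M \<Otimes>\<^sub>M N) N snd) B = emeasure N B"
        using B by (simp add: emeasure_distr Y.emeasure_pair_measure_Times X.emeasure_space_1)
    qed simp
    fix s
    have "distr M M (F s) \<Otimes>\<^sub>M distr N N (G s)
        = distr (M \<Otimes>\<^sub>M N) (M \<Otimes>\<^sub>M N) (\<lambda>(x, y). (F s x, G s y))"
      using Y.measure_preserving[of s] Y.sigma_finite_measure_axioms
      by (intro pair_measure_distr) auto
    then show "distr (M \<Otimes>\<^sub>M N) (M \<Otimes>\<^sub>M N) (map_prod (F s) (G s)) = M \<Otimes>\<^sub>M N"
      by (simp add: X.measure_preserving Y.measure_preserving map_prod_def)
  qed simp
qed

theorem proposition2:
  fixes M :: "'a::{metric_space, second_countable_topology} measure"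
    and N :: "'b::second_countable_topology measure"
    and F\<^sub>1 :: "real \<Rightarrow> 'a \<Rightarrow> 'a"
    and F\<^sub>2 :: "real \<Rightarrow> 'b \<Rightarrow> 'b"
    and c :: real
    and t :: "nat \<Rightarrow> real"
  assumes "ergodic_pmp_flow M F\<^sub>1"
    and "ergodic_pmp_flow N F\<^sub>2"
    and "c > 0"
    and "partial_rigidity_seq M F\<^sub>1 c t"
    and "condition_star N (koopman F\<^sub>2) t"
  shows "disjoint_flows M F\<^sub>1 N F\<^sub>2"
proof -
  interpret X: ergodic_pmp_flow M F\<^sub>1 by fact
  interpret Y: ergodic_pmp_flow N F\<^sub>2 by fact
  obtain S where S: "\<And>i. S i \<in> sets M" "\<And>i. c \<le> measure M (S i)"
    and rigid: "(\<lambda>i. \<integral>\<^sup>+x\<in>S i. ennreal (dist (F\<^sub>1 (t i) x) x) \<partial>M) \<longlonglongrightarrow> 0"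
    and inv: "\<And>s. (\<lambda>i. measure M (sym_diff (F\<^sub>1 s ` S i) (S i))) \<longlonglongrightarrow> 0"
    using assms(4) unfolding partial_rigidity_seq_def by blast
  have "L = M \<Otimes>\<^sub>M N" if "joining M F\<^sub>1 N F\<^sub>2 L" for L
  proof -
    interpret L: prob_space L using that by (simp add: joining_def)
    interpret rigid_joining M F\<^sub>1 N F\<^sub>2 L c t S
    proof unfold_locales
      show "asymptotically_invariant M F\<^sub>1 S"
        using S(1) inv by (simp add: asymptotically_invariant_def)
      show "(\<lambda>i. displacement M F\<^sub>1 (t i) (S i) (indicator A)) \<longlonglongrightarrow> 0" if "A \<in> sets M" for A
        by (rule partial_rigidity_moves_sets_little[OF X.pmp_flow_axioms S(1) rigid that])
    qed (use that S assms(3) in \<open>simp_all add: joining_def\<close>)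
    show ?thesis by (rule joining_eq_product[OF assms(5)])
  qed
  then show ?thesis
    using product_is_joining[OF X.pmp_flow_axioms Y.pmp_flow_axioms]
    unfolding disjoint_flows_def by blast
qed

end
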